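(* Let $G$ be an infinite countable discrete amenable group with a F\o lner sequence $\mathbf{F}$, and let $(X,\mathcal{B}_X,\mu,G)$ be a $G$-MPS. Then the following three conditions are equivalent: (1) $(X,\mathcal{B}_X,\mu,G)$ is weakly mixing; (2) for any finite measurable partition $\alpha$ of $X$, there exists some infinite subset $S$ of $G$ such that $h_\mu^{S,\mathbf{F}}(G,\alpha)=H_\mu(\alpha)$; (3) for any non-trivial finite measurable partition $\alpha$ of $X$, there exists some infinite subset $S$ of $G$ such that $h_\mu^{S,\mathbf{F}}(G,\alpha)>0$.
   Context: The F\o lner sequence $\mathbf{F}=\{F_n\}_{n=1}^\infty$ is a sequence of finite subsets of $G$ with $\lim_{n\to\infty}|gF_n\triangle F_n|/|F_n|=0$ for every $g\in G$, $e_G\in F_1\subseteq F_2\subseteq\cdots$ and $\bigcup_n F_n=G$. A $G$-system $(X,G)$ is a compact metric space $X$ with a continuous action of $G$. A $G$-MPS $(X,\mathcal{B}_X,\mu,G)$ consists of a $G$-system $(X,G)$, its Borel $\sigma$-algebra $\mathcal{B}_X$, and a $G$-invariant Borel probability measure $\mu$. It is weakly mixing if the product system $(X\times X,\mathcal{B}_X\times\mathcal{B}_X,\mu\times\mu,G)$ with the diagonal action $g(x,y)=(gx,gy)$ is ergodic. For a finite measurable partition $\alpha$ of $X$, $H_\mu(\alpha)=-\sum_{A\in\alpha}\mu(A)\log\mu(A)$ (with $0\log 0=0$), $g^{-1}\alpha=\{g^{-1}A:A\in\alpha\}$ and $\bigvee$ denotes the common refinement. A partition $\alpha$ is non-trivial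 if it contains an element $A$ with $0<\mu(A)<1$ (equivalently $H_\mu(\alpha)>0$). For an infinite subset $S\subset G$, $$h_\mu^{S,\mathbf{F}}(G,\alpha)=\limsup_{n\to\infty}\frac{1}{|S\cap F_n|}H_\mu\Big(\bigvee_{g\in S\cap F_n}g^{-1}\alpha\Big).$$ *)

theory Defs
  imports "HOL-Probability.Probability" "HOL-Algebra.Group_Action"
begin

definition asymp_invariant :: "('g, 'b) monoid_scheme \<Rightarrow> (nat \<Rightarrow> 'g set) \<Rightarrow> bool" where
  "asymp_invariant G F \<longleftrightarrow>
     (\<forall>g\<in>carrier G.
        (\<lambda>n. real (card (sym_diff (g <#\<^bsub>G\<^esub> F n) (F n))) / real (card (F n))) \<longlonglongrightarrow> 0)"

(* Amenability of a countable discrete group, by Folner's condition. *)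
locale countable_amenable_group = group G for G (structure) +
  assumes countable_carrier: "countable (carrier G)"
    and amenable: "\<exists>F. (\<forall>n. finite (F n) \<and> F n \<noteq> {} \<and> F n \<subseteq> carrier G) \<and> asymp_invariant G F"

(* Indexing starts at 0: F n here is the (n+1)-st set of a sequence indexed from 1. *)
locale folner_sequence =
  fixes G (structure) and F :: "nat \<Rightarrow> 'a set"
  assumes finite_F: "finite (F n)"
    and one_in_F0: "\<one> \<in> F 0"
    and incseq_F: "incseq F"
    and Union_F: "(\<Union>n. F n) = carrier G"
    and asymp_invariant_F: "asymp_invariant G F"

(* The space is the whole type 'x. The group is discrete, so joint continuity of the
   action is continuity of every single map act g. *)
locale G_system = group_action G "UNIV :: 'x set" act
  for G (structure) and act :: "'g \<Rightarrow> 'x::metric_space \<Rightarrow> 'x" +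
  assumes compact_space: "compact (UNIV :: 'x set)"
    and continuous_act: "g \<in> carrier G \<Longrightarrow> continuous_on UNIV (act g)"

locale G_MPS = G_system G act + prob_space M
  for G (structure) and act :: "'g \<Rightarrow> 'x::metric_space \<Rightarrow> 'x" and M :: "'x measure" +
  assumes sets_M: "sets M = sets borel"
    and invariant_M: "\<lbrakk>g \<in> carrier G; A \<in> sets M\<rbrakk> \<Longrightarrow>
          emeasure M (act g -` A \<inter> space M) = emeasure M A"

(* Meant for probability measures M. *)
definition ergodic_action :: "('g, 'b) monoid_scheme \<Rightarrow> ('g \<Rightarrow> 'x \<Rightarrow> 'x) \<Rightarrow> 'x measure \<Rightarrow> bool" where
  "ergodic_action G act M \<longleftrightarrow>
     (\<forall>A\<in>sets M. (\<forall>g\<in>carrier G. act g -` A \<inter> space M = A) \<longrightarrow> measure M A = 0 \<or> measure M A = 1)"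

definition weakly_mixing :: "('g, 'b) monoid_scheme \<Rightarrow> ('g \<Rightarrow> 'x \<Rightarrow> 'x) \<Rightarrow> 'x measure \<Rightarrow> bool" where
  "weakly_mixing G act M \<longleftrightarrow>
     ergodic_action G (\<lambda>g (x, y). (act g x, act g y)) (M \<Otimes>\<^sub>M M)"

(* partition_on excludes the empty cell, which would contribute 0 to every entropy. *)
definition finite_measurable_partition :: "'x measure \<Rightarrow> 'x set set \<Rightarrow> bool" where
  "finite_measurable_partition M \<alpha> \<longleftrightarrow> finite \<alpha> \<and> \<alpha> \<subseteq> sets M \<and> partition_on (space M) \<alpha>"

definition nontrivial_partition :: "'x measure \<Rightarrow> 'x set set \<Rightarrow> bool" where
  "nontrivial_partition M \<alpha> \<longleftrightarrow> (\<exists>A\<in>\<alpha>. 0 < measure M A \<and> measure M A < 1)"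

(* ln 0 = 0, so the convention 0 log 0 = 0 holds. *)
definition partition_entropy :: "'x measure \<Rightarrow> 'x set set \<Rightarrow> real" where
  "partition_entropy M \<alpha> = - (\<Sum>A\<in>\<alpha>. measure M A * ln (measure M A))"

definition preimage_partition :: "'x measure \<Rightarrow> ('x \<Rightarrow> 'x) \<Rightarrow> 'x set set \<Rightarrow> 'x set set" where
  "preimage_partition M T \<alpha> = (\<lambda>A. T -` A \<inter> space M) ` \<alpha>"

(* Common refinement of the partitions \<beta> i, i \<in> I; it is {space M} if I is empty. *)
definition join_partitions :: "'x measure \<Rightarrow> 'i set \<Rightarrow> ('i \<Rightarrow> 'x set set) \<Rightarrow> 'x set set" where
  "join_partitions M I \<beta> = {space M \<inter> (\<Inter>i\<in>I. B i) | B. \<forall>i\<in>I. B i \<in> \<beta> i} - {{}}"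

(* If S \<inter> F n is empty, the n-th term is 0. When F is increasing and exhausts the group and S is
   nonempty, this affects finitely many n only. *)
definition seq_entropy ::
  "('g \<Rightarrow> 'x \<Rightarrow> 'x) \<Rightarrow> 'x measure \<Rightarrow> (nat \<Rightarrow> 'g set) \<Rightarrow> 'g set \<Rightarrow> 'x set set \<Rightarrow> ereal" where
  "seq_entropy act M F S \<alpha> =
     limsup (\<lambda>n. ereal (1 / real (card (S \<inter> F n)) *
       partition_entropy M (join_partitions M (S \<inter> F n) (\<lambda>g. preimage_partition M (act g) \<alpha>))))"

end

theory Submission
  imports Defs "HOL-Real_Asymp.Real_Asymp"
begin

text \<open>
  Under weak mixing, the mean ergodic theorem for the diagonal action on \<open>X \<times> X\<close>, applied to
  \<open>f(x) f(y)\<close> with \<open>f = 1\<^sub>A - \<mu>(A)\<close>, makes \<open>g\<^sup>-\<^sup>1A\<close> almost independent of \<open>B\<close> for some \<open>g\<close>, simultaneously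
  for finitely many pairs \<open>(A, B)\<close>. Choosing the elements of \<open>S\<close> one by one such that \<open>g\<^sup>-\<^sup>1\<alpha>\<close> is almost
  independent, with summable errors, of the join over every subset of the elements chosen before,
  the join over a finite subset \<open>E\<close> of \<open>S\<close> has entropy \<open>|E| H(\<alpha>)\<close> up to a bounded error.

  Conversely, let \<open>E\<close> be an invariant subset of \<open>X \<times> X\<close> of measure neither 0 nor 1. If all functions
  \<open>x \<mapsto> \<mu>(E\<^sub>x \<inter> B)\<close>, also those of the transposed set, were constant, then \<open>E\<close> would be independent of
  every rectangle and hence of itself. The orbit of such a function lies in the totally bounded
  family of all \<open>x \<mapsto> \<mu>(E\<^sub>x \<inter> C)\<close>, so a nonconstant one has a nontrivial level set \<open>A\<close> with totally
  bounded orbit. Up to a small conditional entropy only finitely many of the partitions into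
  \<open>g\<^sup>-\<^sup>1A\<close> and its complement are different, and the entropy vanishes along every sequence.
\<close>

section \<open>Entropy of joins\<close>

text \<open>The contribution of a cell of mass t to the entropy. Since \<open>eta 0 = 0\<close>,
  sums may run over all pairs of cells, including those with empty intersection.\<close>

definition eta :: "real \<Rightarrow> real" where
  "eta t = - (t * ln t)"

lemma eta_0 [simp]: "eta 0 = 0" and eta_1 [simp]: "eta 1 = 0"
  by (simp_all add: eta_def)

lemma eta_nonneg: "0 \<le> t \<Longrightarrow> t \<le> 1 \<Longrightarrow> 0 \<le> eta t"
  by (cases "t = 0") (auto simp: eta_def mult_nonneg_nonpos)

text \<open>The logarithm turns the product into a sum; this is the source of additivity of entropy
  for independent partitions. Zero factors are split off because the product rule for
  \<open>ln\<close> fails there.\<close>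

lemma eta_mult: "0 \<le> a \<Longrightarrow> 0 \<le> b \<Longrightarrow> eta (a * b) = a * eta b + b * eta a"
  by (cases "a = 0"; cases "b = 0") (auto simp: eta_def ln_mult algebra_simps)

lemma continuous_on_eta: "continuous_on {0..1} eta"
proof (rule continuous_on_eq_continuous_within[THEN iffD2], intro ballI)
  fix t :: real assume t: "t \<in> {0..1}"
  show "continuous (at t within {0..1}) eta"
  proof (cases "t = 0")
    case True
    have "((\<lambda>t::real. - (t * ln t)) \<longlongrightarrow> 0) (at_right 0)" by real_asymp
    \<comment> \<open>The filter at 0 does not see the point 0 itself, so the right-hand limit of
      \<open>- (t * ln t)\<close> already gives the limit within the interval.\<close>
    moreover have "at (0::real) within {0..1} = at 0 within {0<..1}"
      unfolding at_within_def by (rule arg_cong[where f = "\<lambda>S. inf _ (principal S)"]) auto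
    ultimately have "(eta \<longlongrightarrow> 0) (at 0 within {0..1})"
      unfolding eta_def by (auto elim: tendsto_within_subset)
    then show ?thesis using True by (simp add: continuous_within)
  next
    case False
    then show ?thesis unfolding eta_def by (intro continuous_intros) auto
  qed
qed

lemma eta_uniformly_continuous:
  assumes "0 < e"
  obtains d where "0 < d"
    "\<And>s t. 0 \<le> s \<Longrightarrow> s \<le> 1 \<Longrightarrow> 0 \<le> t \<Longrightarrow> t \<le> 1 \<Longrightarrow> \<bar>s - t\<bar> < d \<Longrightarrow> \<bar>eta s - eta t\<bar> < e"
proof -
  have "uniformly_continuous_on {0..1} eta"
    using continuous_on_eta by (intro compact_uniformly_continuous) auto
  then show thesis
    using assms that by (force simp: uniformly_continuous_on_def dist_real_def)
qed

lemma partition_entropy_eta: "partition_entropy M \<alpha> = (\<Sum>A\<in>\<alpha>. eta (measure M A))"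
  by (simp add: partition_entropy_def eta_def sum_negf)

text \<open>Gibbs' inequality for the split of one cell, against the weights \<open>q\<close> and \<open>1 - q\<close>.\<close>
lemma eta_split_le:
  assumes "0 \<le> a" "0 \<le> b" "0 < q" "q < 1"
  shows "eta a + eta b - eta (a + b) \<le> - a * ln q - b * ln (1 - q)"
proof -
  have gibbs: "x * ln (r * (x + y) / x) \<le> r * (x + y) - x"
    if "0 < x" "0 \<le> y" "0 < r" for x y r :: real
  proof -
    have "ln (r * (x + y) / x) \<le> r * (x + y) / x - 1"
      using that by (intro ln_le_minus_one divide_pos_pos mult_pos_pos) auto
    then have "x * ln (r * (x + y) / x) \<le> x * (r * (x + y) / x - 1)"
      using that by (intro mult_left_mono) auto
    also have "x * (r * (x + y) / x - 1) = r * (x + y) - x"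
      using that by (simp add: right_diff_distrib)
    finally show ?thesis .
  qed
  consider "a = 0" | "b = 0" | "a > 0" "b > 0" using assms by linarith
  then show ?thesis
  proof cases
    case 1
    then show ?thesis using assms by (simp add: mult_nonneg_nonpos)
  next
    case 2
    then show ?thesis using assms by (simp add: mult_nonneg_nonpos)
  next
    case 3
    have "ln (q * (a + b) / a) = ln q + ln (a + b) - ln a"
         "ln ((1 - q) * (b + a) / b) = ln (1 - q) + ln (a + b) - ln b"
      using 3 assms by (simp_all add: ln_mult ln_div add.commute)
    \<comment> \<open>The upper bounds add up to 0 because the weights sum to 1.\<close>
    then have "a * (ln q + ln (a + b) - ln a) + b * (ln (1 - q) + ln (a + b) - ln b)
        \<le> (q * (a + b) - a) + ((1 - q) * (b + a) - b)"
      using gibbs[of a b q] gibbs[of b a "1 - q"] 3 assms by (intro add_mono) auto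
    then show ?thesis by (simp add: eta_def algebra_simps)
  qed
qed

section \<open>Joins and intersections of finite partitions\<close>

lemma join_partitions_iff:
  "x \<in> join_partitions M I \<beta> \<longleftrightarrow>
    x \<noteq> {} \<and> (\<exists>B. x = space M \<inter> (\<Inter>i\<in>I. B i) \<and> (\<forall>i\<in>I. B i \<in> \<beta> i))"
  unfolding join_partitions_def by blast

lemma join_partitions_empty:
  "space M \<noteq> {} \<Longrightarrow> join_partitions M {} \<beta> = {space M}"
  by (auto simp: join_partitions_iff)

text \<open>A choice of cells over \<open>insert i I\<close> is a choice over \<open>I\<close>
  together with one more cell. This reduces joins to repeated binary intersections, in the form
  needed for induction over the index set.\<close>

lemma join_partitions_insert:
  assumes "i \<notin> I"
  shows "join_partitions M (insert i I) \<beta> =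
    {p \<inter> C | p C. p \<in> join_partitions M I \<beta> \<and> C \<in> \<beta> i} - {{}}" (is "?L = ?R")
proof
  show "?L \<subseteq> ?R"
  proof
    fix x assume "x \<in> ?L"
    then obtain B where B: "x = space M \<inter> (\<Inter>j\<in>insert i I. B j)" "\<forall>j\<in>insert i I. B j \<in> \<beta> j" "x \<noteq> {}"
      unfolding join_partitions_iff by blast
    define p where "p = space M \<inter> (\<Inter>j\<in>I. B j)"
    have x: "x = p \<inter> B i" using B(1) unfolding p_def by blast
    have "p \<in> join_partitions M I \<beta>"
      unfolding join_partitions_iff
    proof (intro conjI exI[of _ B])
      show "p \<noteq> {}" using x B(3) by blast
      show "p = space M \<inter> (\<Inter>i\<in>I. B i)" by (fact p_def)
      show "\<forall>i\<in>I. B i \<in> \<beta> i" using B(2) by blast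
    qed
    moreover have "B i \<in> \<beta> i" using B(2) by blast
    ultimately show "x \<in> ?R" using x B(3) by blast
  qed
  show "?R \<subseteq> ?L"
  proof
    fix x assume "x \<in> ?R"
    then obtain p C where *: "x = p \<inter> C" "p \<in> join_partitions M I \<beta>" "C \<in> \<beta> i" "x \<noteq> {}"
      by blast
    then obtain B where B: "p = space M \<inter> (\<Inter>j\<in>I. B j)" "\<forall>j\<in>I. B j \<in> \<beta> j"
      unfolding join_partitions_iff by blast
    \<comment> \<open>As i is new, overriding the choice at i leaves the cells over \<open>I\<close>
      unchanged.\<close>
    have upd: "(B(i := C)) j = B j" if "j \<in> I" for j using that assms by auto
    have "x = space M \<inter> (C \<inter> (\<Inter>j\<in>I. B j))" using *(1) B(1) by blast
    also have "\<dots> = space M \<inter> (\<Inter>j\<in>insert i I. (B(i := C)) j)"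
      by (simp only: INT_insert fun_upd_same upd cong: INF_cong)
    finally have "x = space M \<inter> (\<Inter>j\<in>insert i I. (B(i := C)) j)" .
    moreover have "\<forall>j\<in>insert i I. (B(i := C)) j \<in> \<beta> j" using *(3) B(2) by simp
    ultimately show "x \<in> ?L" using *(4) unfolding join_partitions_iff by blast
  qed
qed

lemma finite_partitionD:
  assumes "finite_measurable_partition M P"
  shows "finite P" "p \<in> P \<Longrightarrow> p \<in> sets M" "\<Union>P = space M" "{} \<notin> P"
    "p \<in> P \<Longrightarrow> p' \<in> P \<Longrightarrow> p \<noteq> p' \<Longrightarrow> p \<inter> p' = {}"
  using assms unfolding finite_measurable_partition_def partition_on_def disjoint_def by blast+

lemma finite_partitionI:
  assumes "finite P" "\<And>p. p \<in> P \<Longrightarrow> p \<in> sets M" "\<Union>P = space M" "{} \<notin> P"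
    "\<And>p p'. p \<in> P \<Longrightarrow> p' \<in> P \<Longrightarrow> p \<noteq> p' \<Longrightarrow> p \<inter> p' = {}"
  shows "finite_measurable_partition M P"
  using assms unfolding finite_measurable_partition_def partition_on_def disjoint_def by blast

lemma finite_partition_Int:
  assumes P: "finite_measurable_partition M P" and Q: "finite_measurable_partition M Q"
  shows "finite_measurable_partition M ({p \<inter> C | p C. p \<in> P \<and> C \<in> Q} - {{}})"
proof (rule finite_partitionI)
  have "\<Union> ({p \<inter> C | p C. p \<in> P \<and> C \<in> Q} - {{}}) = \<Union>P \<inter> \<Union>Q" by blast
  then show "\<Union> ({p \<inter> C | p C. p \<in> P \<and> C \<in> Q} - {{}}) = space M"
    by (simp add: finite_partitionD(3)[OF P] finite_partitionD(3)[OF Q])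
next
  fix x y assume "x \<in> {p \<inter> C | p C. p \<in> P \<and> C \<in> Q} - {{}}"
    and "y \<in> {p \<inter> C | p C. p \<in> P \<and> C \<in> Q} - {{}}" and "x \<noteq> y"
  then obtain p C p' C' where *: "x = p \<inter> C" "y = p' \<inter> C'" "p \<in> P" "p' \<in> P" "C \<in> Q" "C' \<in> Q"
    by blast
  then consider "p \<noteq> p'" | "C \<noteq> C'" using \<open>x \<noteq> y\<close> by blast
  then show "x \<inter> y = {}"
  proof cases
    case 1
    then show ?thesis using finite_partitionD(5)[OF P *(3,4)] * by blast
  next
    case 2
    then show ?thesis using finite_partitionD(5)[OF Q *(5,6)] * by blast
  qed
next
  show "finite ({p \<inter> C | p C. p \<in> P \<and> C \<in> Q} - {{}})"
    using finite_partitionD(1)[OF P] finite_partitionD(1)[OF Q] by (simp add: finite_image_set2)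
next
  fix x assume "x \<in> {p \<inter> C | p C. p \<in> P \<and> C \<in> Q} - {{}}"
  then obtain p C where "x = p \<inter> C" "p \<in> P" "C \<in> Q" by blast
  then show "x \<in> sets M" using finite_partitionD(2)[OF P, of p] finite_partitionD(2)[OF Q, of C] by (simp add: sets.Int)
next
  show "{} \<notin> {p \<inter> C | p C. p \<in> P \<and> C \<in> Q} - {{}}" by blast
qed

text \<open>A nonempty intersection determines the two cells it comes from, so no cell is counted
  twice; pairs with empty intersection contribute \<open>eta 0 = 0\<close> and may be added.\<close>

lemma partition_entropy_Int:
  assumes P: "finite_measurable_partition M P" and Q: "finite_measurable_partition M Q"
  shows "partition_entropy M ({p \<inter> C | p C. p \<in> P \<and> C \<in> Q} - {{}}) =
    (\<Sum>p\<in>P. \<Sum>C\<in>Q. eta (measure M (p \<inter> C)))"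
proof -
  define R where "R = {z \<in> P \<times> Q. fst z \<inter> snd z \<noteq> {}}"
  have eq: "{p \<inter> C | p C. p \<in> P \<and> C \<in> Q} - {{}} = (\<lambda>z. fst z \<inter> snd z) ` R"
  proof (intro equalityI subsetI)
    fix x assume "x \<in> {p \<inter> C | p C. p \<in> P \<and> C \<in> Q} - {{}}"
    then obtain p C where x: "x = p \<inter> C" "p \<in> P" "C \<in> Q" "x \<noteq> {}" by blast
    then have "(p, C) \<in> R" by (simp add: R_def)
    then show "x \<in> (\<lambda>z. fst z \<inter> snd z) ` R" by (rule rev_image_eqI) (simp add: x(1))
  next
    fix x assume "x \<in> (\<lambda>z. fst z \<inter> snd z) ` R"
    then obtain z where z: "z \<in> R" "x = fst z \<inter> snd z" by blast
    then have "fst z \<in> P" "snd z \<in> Q" "x \<noteq> {}" by (simp_all add: R_def mem_Times_iff)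
    then show "x \<in> {p \<inter> C | p C. p \<in> P \<and> C \<in> Q} - {{}}" using z(2) by blast
  qed
  have inj: "inj_on (\<lambda>z. fst z \<inter> snd z) R"
  proof (rule inj_onI)
    fix z z' assume z: "z \<in> R" and z': "z' \<in> R" and eq: "fst z \<inter> snd z = fst z' \<inter> snd z'"
    have mem: "fst z \<in> P" "snd z \<in> Q" "fst z' \<in> P" "snd z' \<in> Q" "fst z \<inter> snd z \<noteq> {}"
      using z z' by (simp_all add: R_def mem_Times_iff)
    have "fst z \<inter> fst z' \<noteq> {}" "snd z \<inter> snd z' \<noteq> {}" using mem(5) eq by blast+
    then show "z = z'"
      using finite_partitionD(5)[OF P mem(1,3)] finite_partitionD(5)[OF Q mem(2,4)] by (metis prod_eqI)
  qed
  have fin: "finite (P \<times> Q)" using finite_partitionD(1)[OF P] finite_partitionD(1)[OF Q] by simp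
  have "partition_entropy M ({p \<inter> C | p C. p \<in> P \<and> C \<in> Q} - {{}}) =
    (\<Sum>z\<in>R. eta (measure M (fst z \<inter> snd z)))"
    unfolding partition_entropy_eta eq sum.reindex[OF inj] by simp
  also have "\<dots> = (\<Sum>z\<in>P \<times> Q. eta (measure M (fst z \<inter> snd z)))"
    by (rule sum.mono_neutral_left[OF fin]) (auto simp: R_def)
  finally show ?thesis by (simp add: sum.cartesian_product case_prod_unfold)
qed

section \<open>Entropy of joins and of splits into two cells\<close>

context prob_space
begin

lemma finite_partition_space: "finite_measurable_partition M {space M}"
  using not_empty by (intro finite_partitionI) auto

lemma finite_partition_join:
  assumes "finite I" "\<And>i. i \<in> I \<Longrightarrow> finite_measurable_partition M (\<beta> i)"
  shows "finite_measurable_partition M (join_partitions M I \<beta>)"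
  using assms
proof (induction I)
  case empty
  then show ?case using finite_partition_space by (simp add: join_partitions_empty not_empty)
next
  case (insert i I)
  then show ?case by (simp add: join_partitions_insert finite_partition_Int)
qed

lemma partition_entropy_join_insert:
  assumes "finite I" "i \<notin> I" "\<And>j. j \<in> insert i I \<Longrightarrow> finite_measurable_partition M (\<beta> j)"
  shows "partition_entropy M (join_partitions M (insert i I) \<beta>) =
    (\<Sum>p\<in>join_partitions M I \<beta>. \<Sum>C\<in>\<beta> i. eta (prob (p \<inter> C)))"
  using assms by (simp add: join_partitions_insert partition_entropy_Int finite_partition_join)

lemma prob_sum_partition:
  assumes P: "finite_measurable_partition M P" and D: "D \<in> sets M"
  shows "(\<Sum>p\<in>P. prob (p \<inter> D)) = prob D"
proof -
  have "(\<Sum>p\<in>P. prob (p \<inter> D)) = prob (\<Union>p\<in>P. p \<inter> D)"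
  proof (rule finite_measure_finite_Union[symmetric])
    show "finite P" by (rule finite_partitionD(1)[OF P])
    show "(\<lambda>p. p \<inter> D) ` P \<subseteq> sets M" using finite_partitionD(2)[OF P] D by auto
    show "disjoint_family_on (\<lambda>p. p \<inter> D) P"
      using finite_partitionD(5)[OF P] unfolding disjoint_family_on_def by blast
  qed
  also have "(\<Union>p\<in>P. p \<inter> D) = D"
    using finite_partitionD(3)[OF P] sets.sets_into_space[OF D] by blast
  finally show ?thesis .
qed

text \<open>Weight 1/2 in \<open>eta_split_le\<close> charges every cell its mass times
  \<open>ln 2\<close>, and the masses sum to 1.\<close>

lemma entropy_split_le_ln2:
  assumes P: "finite_measurable_partition M P" and A: "A \<in> sets M"
  shows "(\<Sum>p\<in>P. eta (prob (p \<inter> A)) + eta (prob (p \<inter> (space M - A)))) \<le> partition_entropy M P + ln 2"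
proof -
  have "eta (prob (p \<inter> A)) + eta (prob (p \<inter> (space M - A))) \<le> eta (prob p) + prob p * ln 2" if "p \<in> P" for p
  proof -
    have "prob p = prob (p \<inter> A) + prob (p \<inter> (space M - A))"
      using finite_partitionD(2)[OF P that] A sets.sets_into_space[OF finite_partitionD(2)[OF P that]]
      by (subst finite_measure_Union[symmetric]) (auto intro!: arg_cong[where f = prob])
    then show ?thesis
      using eta_split_le[of "prob (p \<inter> A)" "prob (p \<inter> (space M - A))" "1/2"]
      by (simp add: ln_div algebra_simps)
  qed
  then have "(\<Sum>p\<in>P. eta (prob (p \<inter> A)) + eta (prob (p \<inter> (space M - A)))) \<le>
      (\<Sum>p\<in>P. eta (prob p) + prob p * ln 2)"
    by (rule sum_mono)
  also have "\<dots> = partition_entropy M P + (\<Sum>p\<in>P. prob (p \<inter> space M)) * ln 2"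
    using finite_partitionD(2)[OF P] by (simp add: partition_entropy_eta sum.distrib sum_distrib_right)
  also have "(\<Sum>p\<in>P. prob (p \<inter> space M)) = 1"
    using prob_sum_partition[OF P, of "space M"] by (simp add: prob_space)
  finally show ?thesis by simp
qed

text \<open>Every cell lies inside \<open>A'\<close> or misses it, so splitting it by
  \<open>A\<close> cuts off only a piece of the symmetric difference. In \<open>eta_split_le\<close>
  the weight \<epsilon> goes to that piece and 1 - \<epsilon> to the rest: the pieces, of total mass
  at most \<epsilon>, pay \<open>- ln \<epsilon>\<close> per unit of mass, and the rest pays
  \<open>- ln (1 - \<epsilon>)\<close>.\<close>

lemma entropy_split_le_small:
  assumes P: "finite_measurable_partition M P" and A: "A \<in> sets M" and A': "A' \<in> sets M"
    and ref: "\<And>p. p \<in> P \<Longrightarrow> p \<subseteq> A' \<or> p \<inter> A' = {}"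
    and close: "prob (sym_diff A A') \<le> \<epsilon>" and \<epsilon>: "0 < \<epsilon>" "\<epsilon> < 1"
  shows "(\<Sum>p\<in>P. eta (prob (p \<inter> A)) + eta (prob (p \<inter> (space M - A)))) \<le>
    partition_entropy M P + (- ln (1 - \<epsilon>) - \<epsilon> * ln \<epsilon>)"
proof -
  have "eta (prob (p \<inter> A)) + eta (prob (p \<inter> (space M - A))) \<le>
      eta (prob p) + (prob p * (- ln (1 - \<epsilon>)) + prob (p \<inter> sym_diff A A') * (- ln \<epsilon>))" if "p \<in> P" for p
  proof -
    note p = finite_partitionD(2)[OF P that] sets.sets_into_space[OF finite_partitionD(2)[OF P that]]
    have sum: "prob p = prob (p \<inter> A) + prob (p \<inter> (space M - A))"
      using A p by (subst finite_measure_Union[symmetric]) (auto intro!: arg_cong[where f = prob])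
    have ln: "ln (1 - \<epsilon>) \<le> 0" "ln \<epsilon> \<le> 0" using \<epsilon> by auto
    consider "p \<subseteq> A'" | "p \<inter> A' = {}" using ref[OF \<open>p \<in> P\<close>] by blast
    then show ?thesis
    proof cases
      case 1
      then have "p \<inter> sym_diff A A' = p \<inter> (space M - A)" using p by blast
      moreover have "prob (p \<inter> A) * (- ln (1 - \<epsilon>)) \<le> prob p * (- ln (1 - \<epsilon>))"
        using ln sum by (intro mult_right_mono) auto
      ultimately show ?thesis
        using eta_split_le[of "prob (p \<inter> A)" "prob (p \<inter> (space M - A))" "1 - \<epsilon>"] \<epsilon>
        by (simp add: sum algebra_simps)
    next
      case 2
      then have "p \<inter> sym_diff A A' = p \<inter> A" using p by blast
      moreover have "prob (p \<inter> (space M - A)) * (- ln (1 - \<epsilon>)) \<le> prob p * (- ln (1 - \<epsilon>))"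
        using ln sum by (intro mult_right_mono) auto
      ultimately show ?thesis
        using eta_split_le[of "prob (p \<inter> A)" "prob (p \<inter> (space M - A))" "\<epsilon>"] \<epsilon>
        by (simp add: sum algebra_simps)
    qed
  qed
  then have "(\<Sum>p\<in>P. eta (prob (p \<inter> A)) + eta (prob (p \<inter> (space M - A)))) \<le>
      (\<Sum>p\<in>P. eta (prob p) + (prob p * (- ln (1 - \<epsilon>)) + prob (p \<inter> sym_diff A A') * (- ln \<epsilon>)))"
    by (rule sum_mono)
  also have "\<dots> = partition_entropy M P + (\<Sum>p\<in>P. prob (p \<inter> space M)) * (- ln (1 - \<epsilon>))
      + (\<Sum>p\<in>P. prob (p \<inter> sym_diff A A')) * (- ln \<epsilon>)"
    using finite_partitionD(2)[OF P]
    by (simp only: partition_entropy_eta sum.distrib sum_distrib_right sets.Int_space_eq2) simp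
  also have "\<dots> = partition_entropy M P - ln (1 - \<epsilon>) + prob (sym_diff A A') * (- ln \<epsilon>)"
    using A A' by (subst (1 2) prob_sum_partition[OF P]) (auto simp: prob_space)
  also have "prob (sym_diff A A') * (- ln \<epsilon>) \<le> \<epsilon> * (- ln \<epsilon>)"
    using close \<epsilon> by (intro mult_right_mono) auto
  finally show ?thesis by simp
qed

text \<open>The sets are added one at a time. The first set with a given label costs at most
  \<open>ln 2\<close>; a set whose label has occurred costs only the small amount, because the join
  already refines a set \<epsilon>-close to it. Properness of the sets excludes empty cells.\<close>

lemma entropy_join_two_cells_le:
  fixes A :: "'i \<Rightarrow> 'a set" and c :: "'i \<Rightarrow> 'l"
  assumes E: "finite E" and A: "\<And>i. i \<in> E \<Longrightarrow> A i \<in> sets M"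
    and proper: "\<And>i. i \<in> E \<Longrightarrow> A i \<noteq> {}" "\<And>i. i \<in> E \<Longrightarrow> A i \<noteq> space M"
    and close: "\<And>i j. i \<in> E \<Longrightarrow> j \<in> E \<Longrightarrow> c i = c j \<Longrightarrow> prob (sym_diff (A i) (A j)) \<le> \<epsilon>"
    and \<epsilon>: "0 < \<epsilon>" "\<epsilon> < 1"
  shows "partition_entropy M (join_partitions M E (\<lambda>i. {A i, space M - A i})) \<le>
    card (c ` E) * ln 2 + card E * (- ln (1 - \<epsilon>) - \<epsilon> * ln \<epsilon>)"
  using E A proper close
proof (induction E)
  case empty
  then show ?case
    by (simp add: join_partitions_empty not_empty partition_entropy_eta prob_space)
next
  case (insert i E)
  let ?\<beta> = "\<lambda>i. {A i, space M - A i}"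
  let ?P = "join_partitions M E ?\<beta>"
  let ?\<delta> = "- ln (1 - \<epsilon>) - \<epsilon> * ln \<epsilon>"
  have fmp: "finite_measurable_partition M (?\<beta> j)" if "j \<in> insert i E" for j
    using insert.prems(1-3)[OF that] sets.sets_into_space[OF insert.prems(1)[OF that]] by (intro finite_partitionI) auto
  have P: "finite_measurable_partition M ?P"
    using insert.hyps fmp by (intro finite_partition_join) auto
  \<comment> \<open>The two cells must be distinct for the sum over the two-element set to have two
    terms.\<close>
  have ne: "A i \<noteq> space M - A i" 
    using insert.prems(2)[of i] sets.sets_into_space[OF insert.prems(1)[of i]] by auto
  have H: "partition_entropy M (join_partitions M (insert i E) ?\<beta>) =
      (\<Sum>p\<in>?P. eta (prob (p \<inter> A i)) + eta (prob (p \<inter> (space M - A i))))"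
    using partition_entropy_join_insert[of E i ?\<beta>] insert.hyps fmp ne by simp
  have IH: "partition_entropy M ?P \<le> card (c ` E) * ln 2 + card E * ?\<delta>"
    using insert by auto
  have "\<epsilon> * ln \<epsilon> \<le> 0" "ln (1 - \<epsilon>) \<le> 0"
    using \<epsilon> by (simp_all add: mult_nonneg_nonpos)
  then have \<delta>: "0 \<le> ?\<delta>" by linarith
  show ?case
  proof (cases "c i \<in> c ` E")
    case True
    then obtain j where j: "j \<in> E" "c i = c j" by auto
    \<comment> \<open>With j in \<open>E\<close>, the join \<open>?P\<close> refines the partition
      into \<open>A j\<close> and its complement.\<close>
    have "p \<subseteq> A j \<or> p \<inter> A j = {}" if "p \<in> ?P" for p
      using that j(1) unfolding join_partitions_def by blast
    then have "(\<Sum>p\<in>?P. eta (prob (p \<inter> A i)) + eta (prob (p \<inter> (space M - A i)))) \<le>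
        partition_entropy M ?P + ?\<delta>"
      using insert.prems j \<epsilon> by (intro entropy_split_le_small[OF P, of _ "A j"]) auto
    moreover have "c ` insert i E = c ` E" using True by auto
    ultimately show ?thesis using H IH insert.hyps by (simp add: algebra_simps)
  next
    case False
    have "(\<Sum>p\<in>?P. eta (prob (p \<inter> A i)) + eta (prob (p \<inter> (space M - A i)))) \<le>
        partition_entropy M ?P + ln 2"
      using insert.prems by (intro entropy_split_le_ln2[OF P]) auto
    moreover have "card (c ` insert i E) = Suc (card (c ` E))"
      using False insert.hyps by simp
    ultimately show ?thesis using H IH insert.hyps \<delta> by (simp add: algebra_simps)
  qed
qed

end

section \<open>A mean ergodic theorem\<close>

text \<open>Purely measure-theoretic, without a topology, because it is instantiated with the
  diagonal action on the product space.\<close>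

locale measure_preserving_action = group G + prob_space M
  for G (structure) and M :: "'x measure" and T :: "'g \<Rightarrow> 'x \<Rightarrow> 'x" +
  assumes countable_G: "countable (carrier G)"
    and T_measurable: "g \<in> carrier G \<Longrightarrow> T g \<in> measurable M M"
    and T_distr: "g \<in> carrier G \<Longrightarrow> distr M M (T g) = M"
    and T_mult: "g \<in> carrier G \<Longrightarrow> h \<in> carrier G \<Longrightarrow> T (g \<otimes> h) x = T g (T h x)"
    and T_one: "T \<one> x = x"
begin

lemma AE_T: "AE x in M. P (T g x)" if "g \<in> carrier G" "AE x in M. P x"
proof (rule AE_distrD[OF T_measurable[OF that(1)]])
  show "AE x in distr M M (T g). P x" unfolding T_distr[OF that(1)] by (rule that(2))
qed

lemma expectation_T:
  assumes "g \<in> carrier G" "(v :: 'x \<Rightarrow> real) \<in> borel_measurable M"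
  shows "expectation (\<lambda>x. v (T g x)) = expectation v"
  using integral_distr[OF T_measurable[OF assms(1)] assms(2)] assms(1) by (simp add: T_distr)

text \<open>\<open>ergodic_action\<close> speaks of strictly invariant sets, while v is invariant
  only almost everywhere. The set where every translate of v exceeds the mean is strictly invariant.
  If it had measure 1, the mean would exceed itself; so it is null, v stays below its mean almost
  everywhere, and equality of the integrals forces v to equal the mean.\<close>

lemma AE_invariant_imp_AE_const:
  fixes v :: "'x \<Rightarrow> real"
  assumes erg: "ergodic_action G T M" and int: "integrable M v"
    and inv: "\<And>g. g \<in> carrier G \<Longrightarrow> AE x in M. v (T g x) = v x"
  shows "AE x in M. v x = expectation v"
proof -
  have meas [measurable]: "v \<in> borel_measurable M" using int by simp
  note [measurable] = T_measurable
  define m where "m = expectation v"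
  define A where "A = {x \<in> space M. \<forall>g\<in>carrier G. m < v (T g x)}"
  have A: "A \<in> sets M"
  proof -
    have "A = (\<Inter>g\<in>carrier G. {x \<in> space M. m < v (T g x)})"
      using one_closed by (auto simp: A_def)
    moreover have "{x \<in> space M. m < v (T g x)} \<in> sets M" if "g \<in> carrier G" for g
      using T_measurable[OF that] by measurable
    ultimately show ?thesis
      using one_closed countable_G by (auto intro!: sets.countable_INT')
  qed
  have "T h -` A \<inter> space M = A" if h: "h \<in> carrier G" for h
  proof (rule Set.set_eqI)
    fix x
    have "(\<forall>g\<in>carrier G. m < v (T g (T h x))) \<longleftrightarrow> (\<forall>g\<in>carrier G. m < v (T g x))"
    proof
      assume *: "\<forall>g\<in>carrier G. m < v (T g (T h x))"
      show "\<forall>g\<in>carrier G. m < v (T g x)"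
      proof
        fix g assume g: "g \<in> carrier G"
        then have "T g x = T (g \<otimes> inv h) (T h x)"
          using h by (simp add: T_mult[symmetric] m_assoc)
        then show "m < v (T g x)" using * g h by simp
      qed
    qed (use h in \<open>simp add: T_mult[symmetric]\<close>)
    moreover have "T h x \<in> space M" if "x \<in> space M"
      using measurable_space[OF T_measurable[OF h] that] .
    ultimately show "x \<in> T h -` A \<inter> space M \<longleftrightarrow> x \<in> A" by (auto simp: A_def)
  qed
  then have A01: "prob A = 0 \<or> prob A = 1"
    using erg A by (auto simp: ergodic_action_def)
  \<comment> \<open>Countability of the group brings the quantifier over g inside, so
    \<open>A\<close> agrees almost everywhere with the set where v exceeds m.\<close>
  have "AE x in M. \<forall>g\<in>carrier G. v (T g x) = v x"
    using inv by (simp add: AE_ball_countable[OF countable_G])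
  then have AE_A: "AE x in M. x \<in> A \<longleftrightarrow> m < v x"
    using AE_space by eventually_elim (use one_closed in \<open>auto simp: A_def\<close>)
  from A01 have le: "AE x in M. v x \<le> m"
  proof
    assume "prob A = 0"
    then have "AE x in M. x \<notin> A"
      using A by (simp add: AE_iff_null_sets[symmetric] emeasure_eq_measure null_sets_def)
    then show ?thesis using AE_A by eventually_elim auto
  next
    assume "prob A = 1"
    then have "AE x in M. x \<in> A" by (rule AE_prob_1)
    then have "AE x in M. m < v x" using AE_A by eventually_elim auto
    then have "expectation (\<lambda>_. m) < expectation v"
      using int by (intro integral_less_AE_space) (auto simp: emeasure_space_1)
    then show ?thesis by (simp add: m_def prob_space)
  qed
  have "expectation (\<lambda>x. m - v x) = 0"
    using int by (simp add: m_def prob_space)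
  then have "AE x in M. m - v x = 0"
    using int le by (subst (asm) integral_nonneg_eq_0_iff_AE) auto
  then show ?thesis unfolding m_def by eventually_elim simp
qed

text \<open>Averages over the orbit, built from midpoints so that the parallelogram identity applies.\<close>
inductive_set orbit_hull :: "(('x \<Rightarrow> real) \<Rightarrow> 'x \<Rightarrow> real) set" where
  translate: "g \<in> carrier G \<Longrightarrow> (\<lambda>v x. v (T g x)) \<in> orbit_hull"
| midpoint: "\<Phi> \<in> orbit_hull \<Longrightarrow> \<Psi> \<in> orbit_hull \<Longrightarrow> (\<lambda>v x. (\<Phi> v x + \<Psi> v x) / 2) \<in> orbit_hull"

section \<open>Averaging operators on bounded functions\<close>

lemma orbit_hull_measurable:
  assumes "\<Phi> \<in> orbit_hull" "v \<in> borel_measurable M"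
  shows "\<Phi> v \<in> borel_measurable M"
  using assms(1)
proof induction
  case (translate g)
  then show ?case using measurable_compose[OF T_measurable assms(2)] by simp
next
  case (midpoint \<Phi> \<Psi>)
  then show ?case by measurable
qed

lemma orbit_hull_bounded:
  assumes "\<Phi> \<in> orbit_hull" "\<And>x. \<bar>v x\<bar> \<le> B"
  shows "\<bar>\<Phi> v x\<bar> \<le> B"
  using assms(1)
proof induction
  case (midpoint \<Phi> \<Psi>)
  then show ?case by (simp add: abs_le_iff)
qed (simp add: assms(2))

lemma integrable_bounded:
  "f \<in> borel_measurable M \<Longrightarrow> (\<And>x. \<bar>f x\<bar> \<le> B) \<Longrightarrow> integrable M (f :: 'x \<Rightarrow> real)"
  by (rule integrable_const_bound[where B = B]) auto

lemma expectation_orbit_hull: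
  assumes "\<Phi> \<in> orbit_hull" "v \<in> borel_measurable M" "\<And>x. \<bar>v x\<bar> \<le> B"
  shows "expectation (\<Phi> v) = expectation v"
  using assms(1)
proof induction
  case (translate g)
  then show ?case using expectation_T assms(2) by simp
next
  case (midpoint \<Phi> \<Psi>)
  have "integrable M (\<Phi> v)" "integrable M (\<Psi> v)"
    using midpoint.hyps assms(2,3) orbit_hull_measurable orbit_hull_bounded
    by (blast intro: integrable_bounded)+
  then show ?case using midpoint.IH by simp
qed

text \<open>Translating a translate is again a translate, by \<open>T_mult\<close>. A translated
  near-minimizer thus competes for the same infimum, which is what makes the limit of a minimizing
  sequence invariant.\<close>

lemma orbit_hull_T:
  assumes "\<Phi> \<in> orbit_hull" "g \<in> carrier G"
  shows "(\<lambda>v x. \<Phi> v (T g x)) \<in> orbit_hull"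
  using assms(1)
proof induction
  case (translate h)
  then show ?case using orbit_hull.translate[of "h \<otimes> g"] assms(2) by (simp add: T_mult)
next
  case (midpoint \<Phi> \<Psi>)
  then show ?case using orbit_hull.midpoint by blast
qed

text \<open>Plays the role of completeness of L2. Geometric decay of the squared norms gives
  geometric decay of the L1 norms, so the sum of the absolute values has a finite integral and is
  finite almost everywhere.\<close>

lemma AE_summable_if_square_small:
  fixes d :: "nat \<Rightarrow> 'x \<Rightarrow> real"
  assumes meas: "\<And>n. d n \<in> borel_measurable M" and bd: "\<And>n x. \<bar>d n x\<bar> \<le> B"
    and sq: "\<And>n. expectation (\<lambda>x. (d n x)\<^sup>2) \<le> 4 * (1/4) ^ n"
  shows "AE x in M. summable (\<lambda>n. d n x)"
proof -
  have L1: "expectation (\<lambda>x. \<bar>d n x\<bar>) \<le> 5/2 * (1/2) ^ n" for n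
  proof -
    have "(d n x)\<^sup>2 \<le> B\<^sup>2" for x
      using power_mono[OF bd[of n x], of 2] by simp
    then have int: "integrable M (\<lambda>x. \<bar>d n x\<bar>)" "integrable M (\<lambda>x. (d n x)\<^sup>2)"
      using meas[of n] bd[of n]
      by (intro integrable_bounded[of _ B] integrable_bounded[of _ "B\<^sup>2"]; simp)+
    \<comment> \<open>Arithmetic-geometric mean inequality; the weight \<open>2 ^ n\<close> balances
      the decay \<open>(1/4) ^ n\<close> of the squares, so that both terms decay like
      \<open>(1/2) ^ n\<close>.\<close>
    have "\<bar>d n x\<bar> \<le> ((1/2) ^ n + 2 ^ n * (d n x)\<^sup>2) / 2" for x
    proof -
      have "0 \<le> 2 ^ n * (\<bar>d n x\<bar> - (1/2) ^ n)\<^sup>2" by simp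
      also have "\<dots> = 2 ^ n * (d n x)\<^sup>2 - 2 * (2 ^ n * (1/2) ^ n) * \<bar>d n x\<bar> + (2 ^ n * (1/2) ^ n) * (1/2) ^ n"
        by (simp only: power2_diff power2_abs) (simp only: algebra_simps power2_eq_square)
      also have "(2::real) ^ n * (1/2) ^ n = 1" by (simp add: power_mult_distrib[symmetric])
      finally show ?thesis by simp
    qed
    then have "expectation (\<lambda>x. \<bar>d n x\<bar>) \<le> expectation (\<lambda>x. ((1/2) ^ n + 2 ^ n * (d n x)\<^sup>2) / 2)"
      using int by (intro integral_mono) auto
    also have "\<dots> = ((1/2) ^ n + 2 ^ n * expectation (\<lambda>x. (d n x)\<^sup>2)) / 2"
      using int by (simp add: prob_space)
    also have "\<dots> \<le> ((1/2) ^ n + 2 ^ n * (4 * (1/4) ^ n)) / 2"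
      using sq[of n] by simp
    also have "(2::real) ^ n * (4 * (1/4) ^ n) = 4 * (1/2) ^ n"
      by (simp add: power_mult_distrib[symmetric])
    finally show ?thesis by simp
  qed
  have "(\<integral>\<^sup>+x. (\<Sum>n. ennreal \<bar>d n x\<bar>) \<partial>M) = (\<Sum>n. \<integral>\<^sup>+x. ennreal \<bar>d n x\<bar> \<partial>M)"
    using meas by (intro nn_integral_suminf) measurable
  also have "\<dots> = (\<Sum>n. ennreal (expectation (\<lambda>x. \<bar>d n x\<bar>)))"
    using meas bd by (intro arg_cong[where f = suminf] ext nn_integral_eq_integral integrable_bounded[of _ B]) auto
  also have "\<dots> \<le> (\<Sum>n. ennreal (5/2 * (1/2) ^ n))"
    using L1 by (intro suminf_le ennreal_leI summableI) auto
  also have "\<dots> = ennreal (\<Sum>n. 5/2 * (1/2) ^ n)"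
    by (rule suminf_ennreal2) (auto intro!: summable_mult summable_geometric)
  also have "\<dots> < \<infinity>" by simp
  finally have "(\<integral>\<^sup>+x. (\<Sum>n. ennreal \<bar>d n x\<bar>) \<partial>M) \<noteq> \<infinity>" by simp
  then have "AE x in M. (\<Sum>n. ennreal \<bar>d n x\<bar>) \<noteq> \<infinity>"
    using meas by (intro nn_integral_PInf_AE) measurable
  then show ?thesis
  proof eventually_elim
    case (elim x)
    then have "summable (\<lambda>n. \<bar>d n x\<bar>)" by (intro summable_suminf_not_top) auto
    then show ?case by (rule summable_rabs_cancel)
  qed
qed

text \<open>A norm-minimizing sequence in the hull converges to an invariant function, which by
  ergodicity is constant.\<close>
lemma orbit_hull_small:
  fixes v :: "'i \<Rightarrow> 'x \<Rightarrow> real"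
  assumes erg: "ergodic_action G T M" and I: "finite I"
    and meas: "\<And>i. v i \<in> borel_measurable M" and bd: "\<And>i x. \<bar>v i x\<bar> \<le> 1"
    and mean: "\<And>i. i \<in> I \<Longrightarrow> expectation (v i) = 0" and "0 < \<epsilon>"
  obtains \<Phi> where "\<Phi> \<in> orbit_hull" "\<And>i. i \<in> I \<Longrightarrow> expectation (\<lambda>x. (\<Phi> (v i) x)\<^sup>2) < \<epsilon>"
proof -
  let ?H = orbit_hull
  \<comment> \<open>Summing over the family makes a single averaging operator serve all functions
    \<open>v i\<close> at once.\<close>
  define Q where "Q \<Phi> = (\<Sum>i\<in>I. expectation (\<lambda>x. (\<Phi> (v i) x)\<^sup>2))" for \<Phi> :: "('x \<Rightarrow> real) \<Rightarrow> 'x \<Rightarrow> real"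
  define m where "m = (INF \<Phi>\<in>?H. Q \<Phi>)"
  have Hm [measurable]: "\<Phi> (v i) \<in> borel_measurable M" if "\<Phi> \<in> ?H" for \<Phi> i
    using that meas by (rule orbit_hull_measurable)
  have Hb: "\<bar>\<Phi> (v i) x\<bar> \<le> 1" if "\<Phi> \<in> ?H" for \<Phi> i x
    using that bd by (rule orbit_hull_bounded)
  have Qnn: "0 \<le> Q \<Phi>" for \<Phi> unfolding Q_def by (intro sum_nonneg integral_nonneg) simp
  have bdd: "bdd_below (Q ` ?H)" using Qnn by (auto intro: bdd_belowI[of _ 0])
  have ne: "?H \<noteq> {}" using translate[OF one_closed] by blast
  have m_le: "m \<le> Q \<Phi>" if "\<Phi> \<in> ?H" for \<Phi>
    unfolding m_def using that bdd by (intro cINF_lower)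
  have near: "\<exists>\<Phi>\<in>?H. Q \<Phi> < m + (1/4) ^ n" for n :: nat
    using cINF_less_iff[OF ne bdd, of "m + (1/4) ^ n"] by (simp add: m_def)
  then obtain \<Phi> where \<Phi>: "\<And>n. \<Phi> n \<in> ?H" "\<And>n. Q (\<Phi> n) < m + (1/4) ^ n"
    by metis
  have int_sq: "integrable M (\<lambda>x. (\<Psi> (v i) x)\<^sup>2)" if "\<Psi> \<in> ?H" for \<Psi> i
    using that Hb[OF that] by (intro integrable_bounded[of _ 1]) (auto simp: abs_square_le_1)
  \<comment> \<open>Parallelogram identity: the midpoint lies in the hull, so its \<open>Q\<close>
    is at least m, and two near-minimizers are close in L2.\<close>
  have close: "expectation (\<lambda>x. (\<Psi> (v i) x - \<Psi>' (v i) x)\<^sup>2) \<le> 2 * Q \<Psi> + 2 * Q \<Psi>' - 4 * m"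
    if H: "\<Psi> \<in> ?H" "\<Psi>' \<in> ?H" and i: "i \<in> I" for \<Psi> \<Psi>' i
  proof -
    have eq: "expectation (\<lambda>x. (\<Psi> (v i) x - \<Psi>' (v i) x)\<^sup>2) =
        2 * expectation (\<lambda>x. (\<Psi> (v i) x)\<^sup>2) + 2 * expectation (\<lambda>x. (\<Psi>' (v i) x)\<^sup>2)
        - 4 * expectation (\<lambda>x. ((\<Psi> (v i) x + \<Psi>' (v i) x) / 2)\<^sup>2)" for i
    proof -
      note int = int_sq[OF H(1), of i] int_sq[OF H(2), of i] int_sq[OF midpoint[OF H], of i]
      have "(\<lambda>x. (\<Psi> (v i) x - \<Psi>' (v i) x)\<^sup>2) = (\<lambda>x. 2 * (\<Psi> (v i) x)\<^sup>2 + 2 * (\<Psi>' (v i) x)\<^sup>2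
          - 4 * ((\<Psi> (v i) x + \<Psi>' (v i) x) / 2)\<^sup>2)"
        by (auto simp: power2_eq_square algebra_simps)
      then show ?thesis using int by simp
    qed
    have "expectation (\<lambda>x. (\<Psi> (v i) x - \<Psi>' (v i) x)\<^sup>2) \<le>
        (\<Sum>i\<in>I. expectation (\<lambda>x. (\<Psi> (v i) x - \<Psi>' (v i) x)\<^sup>2))"
      using I i by (intro member_le_sum) auto
    also have "\<dots> = 2 * Q \<Psi> + 2 * Q \<Psi>' - 4 * Q (\<lambda>v x. (\<Psi> v x + \<Psi>' v x) / 2)"
      unfolding eq Q_def by (simp only: sum_subtractf sum.distrib sum_distrib_left)
    finally show ?thesis using m_le[OF midpoint[OF H]] by simp
  qed
  have Q_T: "Q (\<lambda>v x. \<Psi> v (T g x)) = Q \<Psi>" if "\<Psi> \<in> ?H" "g \<in> carrier G" for \<Psi> g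
    unfolding Q_def
    using that by (intro sum.cong refl expectation_T[of g "\<lambda>x. (\<Psi> (v _) x)\<^sup>2"]) auto
  define u where "u i x = lim (\<lambda>n. \<Phi> n (v i) x)" for i x
  have u_meas [measurable]: "u i \<in> borel_measurable M" for i
    unfolding u_def using \<Phi>(1) by (intro borel_measurable_lim_metric) auto
  have u_lim: "AE x in M. (\<lambda>n. \<Phi> n (v i) x) \<longlonglongrightarrow> u i x" if i: "i \<in> I" for i
  proof -
    have "AE x in M. summable (\<lambda>n. \<Phi> n (v i) x - \<Phi> (Suc n) (v i) x)"
    proof (rule AE_summable_if_square_small[where B = 2])
      \<comment> \<open>The two values of \<open>Q\<close> exceed m by less than
        \<open>(1/4) ^ n\<close> and \<open>(1/4) ^ Suc n\<close>, so \<open>close\<close> gives 5/2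
        times \<open>(1/4) ^ n\<close>.\<close>
      show "expectation (\<lambda>x. (\<Phi> n (v i) x - \<Phi> (Suc n) (v i) x)\<^sup>2) \<le> 4 * (1/4) ^ n" for n
        using close[OF \<Phi>(1) \<Phi>(1) i, of n "Suc n"] \<Phi>(2)[of n] \<Phi>(2)[of "Suc n"]
          zero_le_power[of "1/4::real" n] by (simp only: power_Suc) linarith
      show "\<bar>\<Phi> n (v i) x - \<Phi> (Suc n) (v i) x\<bar> \<le> 2" for n x
        using Hb[OF \<Phi>(1), of n i x] Hb[OF \<Phi>(1), of "Suc n" i x] by linarith
    qed (use \<Phi>(1) in measurable)
    then show ?thesis
    proof eventually_elim
      case (elim x)
      then have "(\<lambda>n. \<Phi> 0 (v i) x - (\<Sum>k<n. \<Phi> k (v i) x - \<Phi> (Suc k) (v i) x)) \<longlonglongrightarrow>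
          \<Phi> 0 (v i) x - (\<Sum>k. \<Phi> k (v i) x - \<Phi> (Suc k) (v i) x)"
        by (intro tendsto_diff tendsto_const summable_LIMSEQ)
      also have "(\<lambda>n. \<Phi> 0 (v i) x - (\<Sum>k<n. \<Phi> k (v i) x - \<Phi> (Suc k) (v i) x)) = (\<lambda>n. \<Phi> n (v i) x)"
        by (simp add: sum_lessThan_telescope'[of "\<lambda>n. \<Phi> n (v i) x"])
      finally have "convergent (\<lambda>n. \<Phi> n (v i) x)" by (rule convergentI)
      then show ?case unfolding u_def by (rule convergent_LIMSEQ_iff[THEN iffD1])
    qed
  qed
  have u_bd: "AE x in M. \<bar>u i x\<bar> \<le> 1" if i: "i \<in> I" for i
    using u_lim[OF i]
  proof eventually_elim
    case (elim x)
    then have "(\<lambda>n. \<bar>\<Phi> n (v i) x\<bar>) \<longlonglongrightarrow> \<bar>u i x\<bar>" by (rule tendsto_rabs)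
    then show ?case by (rule LIMSEQ_le_const2) (use Hb[OF \<Phi>(1)] in auto)
  qed
  have u_inv: "AE x in M. u i (T g x) = u i x" if i: "i \<in> I" and g: "g \<in> carrier G" for i g
  proof -
    \<comment> \<open>The translated average lies in the hull and has the same \<open>Q\<close>, so
      \<open>close\<close> applies to the pair. Summable differences tend to 0, which identifies the
      two limits.\<close>
    have "AE x in M. summable (\<lambda>n. \<Phi> n (v i) (T g x) - \<Phi> n (v i) x)"
    proof (rule AE_summable_if_square_small[where B = 2])
      show "expectation (\<lambda>x. (\<Phi> n (v i) (T g x) - \<Phi> n (v i) x)\<^sup>2) \<le> 4 * (1/4) ^ n" for n
        using close[OF orbit_hull_T[OF \<Phi>(1) g] \<Phi>(1) i, of n n] \<Phi>(2)[of n] Q_T[OF \<Phi>(1) g, of n] by simp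
      show "\<bar>\<Phi> n (v i) (T g x) - \<Phi> n (v i) x\<bar> \<le> 2" for n x
        using Hb[OF \<Phi>(1), of n i x] Hb[OF \<Phi>(1), of n i "T g x"] by linarith
      show "(\<lambda>x. \<Phi> n (v i) (T g x) - \<Phi> n (v i) x) \<in> borel_measurable M" for n
        using Hm[OF \<Phi>(1), of n i] measurable_compose[OF T_measurable[OF g] Hm[OF \<Phi>(1), of n i]] by simp
    qed
    then show ?thesis using u_lim[OF i] AE_T[OF g u_lim[OF i]]
    proof eventually_elim
      case (elim x)
      have "(\<lambda>n. \<Phi> n (v i) (T g x) - \<Phi> n (v i) x) \<longlonglongrightarrow> u i (T g x) - u i x"
        using elim by (intro tendsto_diff)
      moreover have "(\<lambda>n. \<Phi> n (v i) (T g x) - \<Phi> n (v i) x) \<longlonglongrightarrow> 0"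
        using elim by (intro summable_LIMSEQ_zero)
      ultimately show ?case using LIMSEQ_unique by fastforce
    qed
  qed
  \<comment> \<open>By ergodicity the limit is constant; averaging preserves the mean 0, so the
    constant is 0. Bounded convergence passes to the squares.\<close>
  have sq_lim: "(\<lambda>n. expectation (\<lambda>x. (\<Phi> n (v i) x)\<^sup>2)) \<longlonglongrightarrow> 0" if i: "i \<in> I" for i
  proof -
    have "integrable M (u i)"
      using u_bd[OF i] by (intro integrable_const_bound[where B = 1]) auto
    then have const: "AE x in M. u i x = expectation (u i)"
      using u_inv[OF i] by (intro AE_invariant_imp_AE_const[OF erg])
    have "(\<lambda>n. expectation (\<Phi> n (v i))) \<longlonglongrightarrow> expectation (u i)"
      using \<Phi>(1) Hb[OF \<Phi>(1)] u_lim[OF i]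
      by (intro integral_dominated_convergence[where w = "\<lambda>_. 1"]) auto
    moreover have "expectation (\<Phi> n (v i)) = 0" for n
      using expectation_orbit_hull[OF \<Phi>(1) meas bd, of n i] mean[OF i] by simp
    ultimately have "expectation (u i) = 0" by (simp add: LIMSEQ_const_iff)
    then have "AE x in M. (\<lambda>n. (\<Phi> n (v i) x)\<^sup>2) \<longlonglongrightarrow> 0\<^sup>2"
      using u_lim[OF i] const by (auto elim!: eventually_elim2 intro!: tendsto_power)
    then have "(\<lambda>n. expectation (\<lambda>x. (\<Phi> n (v i) x)\<^sup>2)) \<longlonglongrightarrow> expectation (\<lambda>_. 0)"
      using \<Phi>(1) Hb[OF \<Phi>(1)]
      by (intro integral_dominated_convergence[where w = "\<lambda>_. 1"]) (auto simp: abs_square_le_1)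
    then show ?thesis by simp
  qed
  have "\<forall>\<^sub>F n in sequentially. \<forall>i\<in>I. expectation (\<lambda>x. (\<Phi> n (v i) x)\<^sup>2) < \<epsilon>"
    by (intro eventually_ball_finite I ballI order_tendstoD(2)[OF sq_lim \<open>0 < \<epsilon>\<close>])
  then obtain n where "\<forall>i\<in>I. expectation (\<lambda>x. (\<Phi> n (v i) x)\<^sup>2) < \<epsilon>"
    by (auto simp: eventually_sequentially)
  then show thesis using that \<Phi>(1) by blast
qed

text \<open>If the sum were at least \<epsilon> for every translate, linearity would give the same
  bound for every operator in the hull, against the existence of one with small L2 norms. The sum
  carries no absolute values; it is applied to correlations that are squares.\<close>

lemma exists_small_correlation:
  fixes v w :: "'i \<Rightarrow> 'x \<Rightarrow> real"
  assumes erg: "ergodic_action G T M" and I: "finite I"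
    and v: "\<And>i. v i \<in> borel_measurable M" "\<And>i x. \<bar>v i x\<bar> \<le> 1" "\<And>i. i \<in> I \<Longrightarrow> expectation (v i) = 0"
    and w: "\<And>i. w i \<in> borel_measurable M" "\<And>i x. \<bar>w i x\<bar> \<le> 1" and "0 < \<epsilon>"
  shows "\<exists>g\<in>carrier G. (\<Sum>i\<in>I. expectation (\<lambda>x. v i (T g x) * w i x)) < \<epsilon>"
proof (rule ccontr)
  assume "\<not> ?thesis"
  then have ge: "\<epsilon> \<le> (\<Sum>i\<in>I. expectation (\<lambda>x. v i (T g x) * w i x))" if "g \<in> carrier G" for g
    using that by (auto simp: not_less)
  have Hb: "\<bar>\<Phi> (v i) x\<bar> \<le> 1" if "\<Phi> \<in> orbit_hull" for \<Phi> i x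
    using that v(2) by (rule orbit_hull_bounded)
  have int: "integrable M (\<lambda>x. \<Phi> (v i) x * w i x)" if "\<Phi> \<in> orbit_hull" for \<Phi> i
    using orbit_hull_measurable[OF that v(1), of i] Hb[OF that, of i] w(1)[of i] w(2)[of i]
    by (intro integrable_bounded[of _ 1]) (auto simp: abs_mult intro!: mult_le_one)
  have hull: "\<epsilon> \<le> (\<Sum>i\<in>I. expectation (\<lambda>x. \<Phi> (v i) x * w i x))" if "\<Phi> \<in> orbit_hull" for \<Phi>
    using that
  proof induction
    case (translate g)
    then show ?case by (rule ge)
  next
    case (midpoint \<Phi> \<Psi>)
    have "(\<Sum>i\<in>I. expectation (\<lambda>x. (\<Phi> (v i) x + \<Psi> (v i) x) / 2 * w i x)) =
        ((\<Sum>i\<in>I. expectation (\<lambda>x. \<Phi> (v i) x * w i x)) + (\<Sum>i\<in>I. expectation (\<lambda>x. \<Psi> (v i) x * w i x))) / 2"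
      using int[OF midpoint.hyps(1)] int[OF midpoint.hyps(2)]
      by (simp add: add_divide_distrib distrib_right sum.distrib sum_divide_distrib)
    then show ?case using midpoint.IH by simp
  qed
  \<comment> \<open>Chosen so that \<open>card I * s < \<epsilon>\<close>; the added 1 also covers
    an empty index set.\<close>
  define s where "s = \<epsilon> / (card I + 1)"
  have s: "0 < s" using \<open>0 < \<epsilon>\<close> by (simp add: s_def)
  obtain \<Phi> where \<Phi>: "\<Phi> \<in> orbit_hull" "\<And>i. i \<in> I \<Longrightarrow> expectation (\<lambda>x. (\<Phi> (v i) x)\<^sup>2) < s\<^sup>2"
    using orbit_hull_small[where v = v and \<epsilon> = "s\<^sup>2", OF erg I v] s by auto
  have "expectation (\<lambda>x. \<Phi> (v i) x * w i x) \<le> s" if i: "i \<in> I" for i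
  proof -
    have int2: "integrable M (\<lambda>x. (\<Phi> (v i) x)\<^sup>2)"
      using orbit_hull_measurable[OF \<Phi>(1) v(1), of i] Hb[OF \<Phi>(1), of i]
      by (intro integrable_bounded[of _ 1]) (auto simp: abs_square_le_1)
    \<comment> \<open>A pointwise substitute for the Cauchy-Schwarz inequality, weighted by
      s.\<close>
    have "\<Phi> (v i) x * w i x \<le> (s + (\<Phi> (v i) x)\<^sup>2 / s) / 2" for x
    proof -
      have "\<Phi> (v i) x * w i x \<le> \<bar>\<Phi> (v i) x\<bar> * \<bar>w i x\<bar>" by (metis abs_ge_self abs_mult)
      also have "\<dots> \<le> \<bar>\<Phi> (v i) x\<bar>" using w(2)[of i x] by (simp add: mult_left_le)
      also have "\<dots> \<le> (s + (\<Phi> (v i) x)\<^sup>2 / s) / 2"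
      proof -
        have "0 \<le> (\<bar>\<Phi> (v i) x\<bar> - s)\<^sup>2 / s" using s by simp
        also have "\<dots> = (\<Phi> (v i) x)\<^sup>2 / s - 2 * \<bar>\<Phi> (v i) x\<bar> + s"
          using s by (simp add: power2_diff field_simps power2_eq_square)
        finally show ?thesis by simp
      qed
      finally show ?thesis .
    qed
    then have "expectation (\<lambda>x. \<Phi> (v i) x * w i x) \<le> expectation (\<lambda>x. (s + (\<Phi> (v i) x)\<^sup>2 / s) / 2)"
      using int[OF \<Phi>(1)] int2 by (intro integral_mono) auto
    also have "\<dots> = (s + expectation (\<lambda>x. (\<Phi> (v i) x)\<^sup>2) / s) / 2"
      using int2 by (simp add: prob_space)
    also have "\<dots> \<le> (s + s\<^sup>2 / s) / 2"
      using \<Phi>(2)[OF i] s by (intro divide_right_mono add_left_mono) auto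
    finally show ?thesis using s by (simp add: power2_eq_square)
  qed
  then have "(\<Sum>i\<in>I. expectation (\<lambda>x. \<Phi> (v i) x * w i x)) \<le> card I * s"
    using sum_mono[of I "\<lambda>i. expectation (\<lambda>x. \<Phi> (v i) x * w i x)" "\<lambda>_. s"] by simp
  also have "\<dots> < \<epsilon>" using \<open>0 < \<epsilon>\<close> by (simp add: s_def field_simps)
  finally show False using hull[OF \<Phi>(1)] by simp
qed

end

section \<open>Sections of a measurable set are totally bounded\<close>

text \<open>Total boundedness of a pseudometric on an index set is expressed by a labelling with finitely
  many labels: indices with the same label are close.\<close>
definition finitely_labelled :: "'i set \<Rightarrow> ('i \<Rightarrow> 'i \<Rightarrow> real) \<Rightarrow> bool" where
  "finitely_labelled I d \<longleftrightarrow> (\<forall>\<epsilon>>0. \<exists>c :: 'i \<Rightarrow> nat. finite (c ` I) \<and>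
     (\<forall>i\<in>I. \<forall>j\<in>I. c i = c j \<longrightarrow> d i j \<le> \<epsilon>))"

section \<open>Total boundedness in terms of labels\<close>

lemma finitely_labelledD:
  fixes I :: "'i set"
  assumes "finitely_labelled I d" "0 < \<epsilon>"
  shows "\<exists>c :: 'i \<Rightarrow> nat. finite (c ` I) \<and> (\<forall>i\<in>I. \<forall>j\<in>I. c i = c j \<longrightarrow> d i j \<le> \<epsilon>)"
  using assms unfolding finitely_labelled_def by blast

lemma finitely_labelled_mono:
  assumes "finitely_labelled I d" "\<And>i j. i \<in> I \<Longrightarrow> j \<in> I \<Longrightarrow> d' i j \<le> d i j"
  shows "finitely_labelled I d'"
  unfolding finitely_labelled_def
proof (intro allI impI)
  fix \<epsilon> :: real assume "0 < \<epsilon>"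
  from finitely_labelledD[OF assms(1) this] show "\<exists>c :: 'a \<Rightarrow> nat. finite (c ` I) \<and> (\<forall>i\<in>I. \<forall>j\<in>I. c i = c j \<longrightarrow> d' i j \<le> \<epsilon>)"
    using assms(2) by (meson order_trans)
qed

lemma finitely_labelled_add:
  assumes "finitely_labelled I d" "finitely_labelled I d'"
  shows "finitely_labelled I (\<lambda>i j. d i j + d' i j)"
  unfolding finitely_labelled_def
proof (intro allI impI)
  fix \<epsilon> :: real assume "0 < \<epsilon>"
  then have "0 < \<epsilon> / 2" by simp
  obtain c :: "_ \<Rightarrow> nat" where "finite (c ` I)"
        "\<forall>i\<in>I. \<forall>j\<in>I. c i = c j \<longrightarrow> d i j \<le> \<epsilon> / 2"
      using finitely_labelledD[OF assms(1) \<open>0 < \<epsilon> / 2\<close>] by blast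
    note c = this(1) this(2)[rule_format]
  obtain c' :: "_ \<Rightarrow> nat" where "finite (c' ` I)"
        "\<forall>i\<in>I. \<forall>j\<in>I. c' i = c' j \<longrightarrow> d' i j \<le> \<epsilon> / 2"
      using finitely_labelledD[OF assms(2) \<open>0 < \<epsilon> / 2\<close>] by blast
    note c' = this(1) this(2)[rule_format]
  show "\<exists>c :: 'a \<Rightarrow> nat. finite (c ` I) \<and> (\<forall>i\<in>I. \<forall>j\<in>I. c i = c j \<longrightarrow> d i j + d' i j \<le> \<epsilon>)"
  proof (intro exI[of _ "\<lambda>i. prod_encode (c i, c' i)"] conjI ballI impI)
    have "(\<lambda>i. prod_encode (c i, c' i)) ` I \<subseteq> prod_encode ` (c ` I \<times> c' ` I)" by blast
    then show "finite ((\<lambda>i. prod_encode (c i, c' i)) ` I)"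
      by (rule finite_subset) (use c(1) c'(1) in simp)
    fix i j assume "i \<in> I" "j \<in> I" "prod_encode (c i, c' i) = prod_encode (c j, c' j)"
    then have "d i j \<le> \<epsilon> / 2" "d' i j \<le> \<epsilon> / 2" using c(2) c'(2) by (simp_all add: prod_encode_eq)
    then show "d i j + d' i j \<le> \<epsilon>" by linarith
  qed
qed

text \<open>The label of i is the number of the interval of length \<epsilon> that contains
  \<open>f i\<close>.\<close>

lemma finitely_labelled_unit_interval:
  assumes "\<And>i. i \<in> I \<Longrightarrow> 0 \<le> f i \<and> f i \<le> (1::real)"
  shows "finitely_labelled I (\<lambda>i j. \<bar>f i - f j\<bar>)"
  unfolding finitely_labelled_def
proof (intro allI impI)
  fix \<epsilon> :: real assume \<epsilon>: "0 < \<epsilon>"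
  show "\<exists>c :: 'a \<Rightarrow> nat. finite (c ` I) \<and> (\<forall>i\<in>I. \<forall>j\<in>I. c i = c j \<longrightarrow> \<bar>f i - f j\<bar> \<le> \<epsilon>)"
  proof (intro exI[of _ "\<lambda>i. nat \<lfloor>f i / \<epsilon>\<rfloor>"] conjI ballI impI)
    have "(\<lambda>i. nat \<lfloor>f i / \<epsilon>\<rfloor>) ` I \<subseteq> {..nat \<lfloor>1 / \<epsilon>\<rfloor>}"
      using assms \<epsilon> by (auto intro!: nat_mono floor_mono divide_right_mono)
    then show "finite ((\<lambda>i. nat \<lfloor>f i / \<epsilon>\<rfloor>) ` I)" by (rule finite_subset) simp
    fix i j assume ij: "i \<in> I" "j \<in> I" "nat \<lfloor>f i / \<epsilon>\<rfloor> = nat \<lfloor>f j / \<epsilon>\<rfloor>"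
    have "0 \<le> f i / \<epsilon>" "0 \<le> f j / \<epsilon>" using assms ij(1,2) \<epsilon> by simp_all
    then have "\<lfloor>f i / \<epsilon>\<rfloor> = \<lfloor>f j / \<epsilon>\<rfloor>" using ij(3) by (simp add: eq_nat_nat_iff)
    then have "\<bar>f i / \<epsilon> - f j / \<epsilon>\<bar> \<le> 1" by linarith
    then show "\<bar>f i - f j\<bar> \<le> \<epsilon>" using \<epsilon> by (simp add: diff_divide_distrib[symmetric] abs_divide)
  qed
qed

section \<open>Section functions of measurable subsets of the product\<close>

context prob_space
begin

lemma measurable_prob_section:
  assumes "E \<in> sets (M \<Otimes>\<^sub>M M)"
  shows "(\<lambda>x. prob (Pair x -` E)) \<in> borel_measurable M"
  using measurable_emeasure_Pair[OF assms] unfolding measure_def by measurable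

lemma integrable_prob_section:
  assumes "E \<in> sets (M \<Otimes>\<^sub>M M)"
  shows "integrable M (\<lambda>x. prob (Pair x -` E))"
  using measurable_prob_section[OF assms] by (intro integrable_const_bound[where B = 1]) auto

lemma measure_pair_eq_section:
  assumes "E \<in> sets (M \<Otimes>\<^sub>M M)"
  shows "measure (M \<Otimes>\<^sub>M M) E = expectation (\<lambda>x. prob (Pair x -` E))"
proof -
  have "emeasure (M \<Otimes>\<^sub>M M) E = (\<integral>\<^sup>+x. ennreal (prob (Pair x -` E)) \<partial>M)"
    using emeasure_pair_measure_alt[OF assms] by (simp add: emeasure_eq_measure)
  also have "\<dots> = ennreal (expectation (\<lambda>x. prob (Pair x -` E)))"
    using integrable_prob_section[OF assms] by (intro nn_integral_eq_integral) auto
  finally show ?thesis by (simp add: measure_def integral_nonneg)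
qed

lemma section_Int: "Pair x -` E \<inter> C = Pair x -` (E \<inter> space M \<times> C)" if "x \<in> space M"
  using that by auto

lemma integrable_prob_section_Int:
  assumes "E \<in> sets (M \<Otimes>\<^sub>M M)" "C \<in> sets M"
  shows "integrable M (\<lambda>x. prob (Pair x -` E \<inter> C))"
proof -
  have *: "E \<inter> space M \<times> C \<in> sets (M \<Otimes>\<^sub>M M)" using assms by simp
  have "integrable M (\<lambda>x. prob (Pair x -` E \<inter> C)) \<longleftrightarrow>
      integrable M (\<lambda>x. prob (Pair x -` (E \<inter> space M \<times> C)))"
    by (rule Bochner_Integration.integrable_cong[OF refl]) (simp only: section_Int)
  then show ?thesis using integrable_prob_section[OF *] by (rule iffD2)
qed

lemma sets_section: "E \<in> sets (M \<Otimes>\<^sub>M M) \<Longrightarrow> Pair x -` E \<in> sets M"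
  by (rule sets_Pair1)

text \<open>The L1 distance between the images of the indicators of \<open>C\<close> and
  \<open>C'\<close> under the integral operator whose kernel is the indicator of
  \<open>E\<close>.\<close>

definition section_dist :: "('a \<times> 'a) set \<Rightarrow> 'a set \<Rightarrow> 'a set \<Rightarrow> real" where
  "section_dist E C C' = expectation (\<lambda>x. \<bar>prob (Pair x -` E \<inter> C) - prob (Pair x -` E \<inter> C')\<bar>)"

lemma section_dist_mono:
  assumes "E \<in> sets (M \<Otimes>\<^sub>M M)" "C \<in> sets M" "C' \<in> sets M" "integrable M f"
    "\<And>x. x \<in> space M \<Longrightarrow> \<bar>prob (Pair x -` E \<inter> C) - prob (Pair x -` E \<inter> C')\<bar> \<le> f x"
  shows "section_dist E C C' \<le> expectation f"
  unfolding section_dist_def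
  using assms by (intro integral_mono integrable_abs Bochner_Integration.integrable_diff integrable_prob_section_Int)

lemma section_dist_le_measure:
  assumes "E \<in> sets (M \<Otimes>\<^sub>M M)" "C \<in> sets M" "C' \<in> sets M"
  shows "section_dist E C C' \<le> measure (M \<Otimes>\<^sub>M M) E"
  unfolding measure_pair_eq_section[OF assms(1)]
proof (rule section_dist_mono[OF assms integrable_prob_section[OF assms(1)]])
  fix x
  have "prob (Pair x -` E \<inter> D) \<le> prob (Pair x -` E)" for D
    using sets_section[OF assms(1)] by (intro finite_measure_mono) auto
  from this[of C] this[of C'] show "\<bar>prob (Pair x -` E \<inter> C) - prob (Pair x -` E \<inter> C')\<bar> \<le> prob (Pair x -` E)"
    using measure_nonneg[of M "Pair x -` E \<inter> C"] measure_nonneg[of M "Pair x -` E \<inter> C'"]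
    by linarith
qed

lemma section_dist_Un:
  assumes E: "E \<in> sets (M \<Otimes>\<^sub>M M)" "E' \<in> sets (M \<Otimes>\<^sub>M M)" "E \<inter> E' = {}"
    and C: "C \<in> sets M" "C' \<in> sets M"
  shows "section_dist (E \<union> E') C C' \<le> section_dist E C C' + section_dist E' C C'"
proof -
  have split: "prob (Pair x -` (E \<union> E') \<inter> D) = prob (Pair x -` E \<inter> D) + prob (Pair x -` E' \<inter> D)"
    if "D \<in> sets M" for x D
  proof -
    have "Pair x -` (E \<union> E') \<inter> D = (Pair x -` E \<inter> D) \<union> (Pair x -` E' \<inter> D)" by blast
    then show ?thesis
      using E that by (simp only:) (intro finite_measure_Union sets.Int sets_section, auto)
  qed
  note int = integrable_abs[OF Bochner_Integration.integrable_diff[OF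
        integrable_prob_section_Int[OF _ C(1)] integrable_prob_section_Int[OF _ C(2)]]]
  have "section_dist (E \<union> E') C C' \<le> expectation (\<lambda>x.
      \<bar>prob (Pair x -` E \<inter> C) - prob (Pair x -` E \<inter> C')\<bar> +
      \<bar>prob (Pair x -` E' \<inter> C) - prob (Pair x -` E' \<inter> C')\<bar>)"
  proof (rule section_dist_mono)
    show "E \<union> E' \<in> sets (M \<Otimes>\<^sub>M M)" using E by simp
    show "\<bar>prob (Pair x -` (E \<union> E') \<inter> C) - prob (Pair x -` (E \<union> E') \<inter> C')\<bar> \<le>
      \<bar>prob (Pair x -` E \<inter> C) - prob (Pair x -` E \<inter> C')\<bar> +
      \<bar>prob (Pair x -` E' \<inter> C) - prob (Pair x -` E' \<inter> C')\<bar>" for x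
      unfolding split[OF C(1)] split[OF C(2)] by linarith
  qed (use int E C in \<open>auto intro: Bochner_Integration.integrable_add\<close>)
  also have "\<dots> = section_dist E C C' + section_dist E' C C'"
    unfolding section_dist_def using int[OF E(1,1)] int[OF E(2,2)]
    by (rule Bochner_Integration.integral_add)
  finally show ?thesis .
qed

text \<open>This is the compactness of the integral operator with kernel \<open>E\<close>,
  restricted to indicators, proved by induction over the product \<sigma>-algebra. For a rectangle
  only the number \<open>prob (B \<inter> C)\<close> matters; a complement adds the number
  \<open>prob C\<close>; a countable disjoint union is a finite one up to a remainder of small
  measure.\<close>

lemma finitely_labelled_sections:
  assumes "E \<in> sets (M \<Otimes>\<^sub>M M)"
  shows "finitely_labelled (sets M) (section_dist E)"
proof -
  let ?R = "{A \<times> B | A B. A \<in> sets M \<and> B \<in> sets M}"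
  have "?R \<subseteq> Pow (space M \<times> space M)"
    using sets.sets_into_space by blast
  from Int_stable_pair_measure_generator[of M M] this assms[unfolded sets_pair_measure]
  show ?thesis
  proof (induction E rule: sigma_sets_induct_disjoint)
    case (basic E)
    then obtain A B where E: "E = A \<times> B" and A: "A \<in> sets M" and B: "B \<in> sets M" by blast
    have "finitely_labelled (sets M) (\<lambda>C C'. \<bar>prob (B \<inter> C) - prob (B \<inter> C')\<bar>)"
      by (rule finitely_labelled_unit_interval) simp
    then show ?case
    proof (rule finitely_labelled_mono)
      fix C C' assume C: "C \<in> sets M" "C' \<in> sets M"
      have sec: "Pair x -` E = (if x \<in> A then B else {})" for x by (auto simp: E)
      have "section_dist E C C' \<le> expectation (\<lambda>_. \<bar>prob (B \<inter> C) - prob (B \<inter> C')\<bar>)"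
        using A B by (intro section_dist_mono C) (auto simp: E sec)
      then show "section_dist E C C' \<le> \<bar>prob (B \<inter> C) - prob (B \<inter> C')\<bar>"
        by (simp add: prob_space)
    qed
  next
    case empty
    show ?case by (auto simp: finitely_labelled_def section_dist_def image_constant_conv intro!: exI[of _ "\<lambda>_. 0"])
  next
    case (compl E)
    have E: "E \<in> sets (M \<Otimes>\<^sub>M M)" using compl.hyps by (simp add: sets_pair_measure)
    have "finitely_labelled (sets M) (\<lambda>C C'. \<bar>prob C - prob C'\<bar> + section_dist E C C')"
      by (intro finitely_labelled_add finitely_labelled_unit_interval compl.IH) simp
    then show ?case
    proof (rule finitely_labelled_mono)
      fix C C' assume C: "C \<in> sets M" "C' \<in> sets M"
      have split: "prob (Pair x -` (space M \<times> space M - E) \<inter> D) = prob D - prob (Pair x -` E \<inter> D)"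
        if "x \<in> space M" "D \<in> sets M" for x D
      proof -
        have "Pair x -` (space M \<times> space M - E) \<inter> D = D - Pair x -` E \<inter> D"
          using that sets.sets_into_space[OF that(2)] by auto
        then show ?thesis
          using that sets_section[OF E] by (simp add: finite_measure_Diff)
      qed
      have int: "integrable M (\<lambda>x. \<bar>prob (Pair x -` E \<inter> C) - prob (Pair x -` E \<inter> C')\<bar>)"
        using integrable_prob_section_Int[OF E] C by simp
      have "section_dist (space M \<times> space M - E) C C' \<le> expectation (\<lambda>x.
          \<bar>prob C - prob C'\<bar> + \<bar>prob (Pair x -` E \<inter> C) - prob (Pair x -` E \<inter> C')\<bar>)"
        using C int E by (intro section_dist_mono) (auto simp: split)
      also have "\<dots> = \<bar>prob C - prob C'\<bar> + section_dist E C C'"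
        unfolding section_dist_def using int by (simp add: prob_space)
      finally show "section_dist (space M \<times> space M - E) C C' \<le> \<bar>prob C - prob C'\<bar> + section_dist E C C'" .
    qed
  next
    case (union D)
    interpret P: pair_prob_space M M ..
    have D: "D n \<in> sets (M \<Otimes>\<^sub>M M)" for n
      using union.hyps(2) by (auto simp: sets_pair_measure)
    \<comment> \<open>Finite unions inherit labellings one set at a time; the countable union is
      then approximated by some \<open>U n\<close> in measure.\<close>
    define U where "U n = (\<Union>i<n. D i)" for n
    have U: "U n \<in> sets (M \<Otimes>\<^sub>M M)" for n using D by (auto simp: U_def)
    have tbU: "finitely_labelled (sets M) (section_dist (U n))" for n
    proof (induction n)
      case 0
      show ?case by (auto simp: U_def finitely_labelled_def section_dist_def image_constant_conv intro!: exI[of _ "\<lambda>_. 0"])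
    next
      case (Suc n)
      have "D i \<inter> D n = {}" if "i < n" for i
        using disjoint_family_onD[OF union.hyps(1) UNIV_I UNIV_I, of i n] that by simp
      then have disj: "U n \<inter> D n = {}" unfolding U_def by blast
      have Suc_eq: "U (Suc n) = U n \<union> D n" unfolding U_def lessThan_Suc by blast
      show ?case unfolding Suc_eq
        by (rule finitely_labelled_mono[OF finitely_labelled_add[OF Suc.IH union.IH[of n]]])
          (rule section_dist_Un[OF U D disj])
    qed
    have UN: "(\<Union>n. U n) = (\<Union>n. D n)" by (auto simp: U_def)
    have "(\<lambda>n. measure (M \<Otimes>\<^sub>M M) (U n)) \<longlonglongrightarrow> measure (M \<Otimes>\<^sub>M M) (\<Union>n. U n)"
    proof (rule P.finite_Lim_measure_incseq)
      show "range U \<subseteq> sets (M \<Otimes>\<^sub>M M)" using U by blast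
      show "incseq U" unfolding incseq_def U_def by (intro allI impI UN_mono) auto
    qed
    then have lim: "(\<lambda>n. measure (M \<Otimes>\<^sub>M M) (U n)) \<longlonglongrightarrow> measure (M \<Otimes>\<^sub>M M) (\<Union>n. D n)"
      by (simp only: UN)
    show ?case
      unfolding finitely_labelled_def
    proof (intro allI impI)
      fix \<epsilon> :: real assume \<epsilon>: "0 < \<epsilon>"
      have "measure (M \<Otimes>\<^sub>M M) (\<Union>n. D n) - \<epsilon> / 2 < measure (M \<Otimes>\<^sub>M M) (\<Union>n. D n)" using \<epsilon> by simp
      from order_tendstoD(1)[OF lim this] obtain n
        where n: "measure (M \<Otimes>\<^sub>M M) (\<Union>n. D n) - \<epsilon> / 2 < measure (M \<Otimes>\<^sub>M M) (U n)"
        by (auto simp: eventually_sequentially)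
      define R where "R = (\<Union>n. D n) - U n"
      have R: "R \<in> sets (M \<Otimes>\<^sub>M M)" using U D by (auto simp: R_def)
      have sub: "U n \<subseteq> (\<Union>n. D n)" by (auto simp: U_def)
      have "measure (M \<Otimes>\<^sub>M M) R < \<epsilon> / 2"
        using n U D sub unfolding R_def by (subst P.finite_measure_Diff) auto
      then have le: "section_dist (\<Union>n. D n) C C' \<le> section_dist (U n) C C' + \<epsilon> / 2"
        if "C \<in> sets M" "C' \<in> sets M" for C C'
      proof -
        \<comment> \<open>The remainder changes the distance by at most its measure, uniformly in
          \<open>C\<close> and \<open>C'\<close>.\<close>
        have "(\<Union>n. D n) = U n \<union> R" "U n \<inter> R = {}" using sub unfolding R_def by blast+
        then have "section_dist (\<Union>n. D n) C C' \<le> section_dist (U n) C C' + section_dist R C C'"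
          using section_dist_Un[OF U R _ that, of n] by simp
        then show ?thesis
          using section_dist_le_measure[OF R that] \<open>measure (M \<Otimes>\<^sub>M M) R < \<epsilon> / 2\<close> by linarith
      qed
      have "0 < \<epsilon> / 2" using \<epsilon> by simp
      obtain c :: "_ \<Rightarrow> nat" where "finite (c ` sets M)"
        "\<forall>C\<in>sets M. \<forall>C'\<in>sets M. c C = c C' \<longrightarrow> section_dist (U n) C C' \<le> \<epsilon> / 2"
      using finitely_labelledD[OF tbU \<open>0 < \<epsilon> / 2\<close>] by blast
    note c = this(1) this(2)[rule_format]
      show "\<exists>c :: 'a set \<Rightarrow> nat. finite (c ` sets M) \<and>
          (\<forall>C\<in>sets M. \<forall>C'\<in>sets M. c C = c C' \<longrightarrow> section_dist (\<Union>n. D n) C C' \<le> \<epsilon>)"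
      proof (intro exI[of _ c] conjI ballI impI c(1))
        fix C C' assume "C \<in> sets M" "C' \<in> sets M" "c C = c C'"
        then show "section_dist (\<Union>n. D n) C C' \<le> \<epsilon>" using le[of C C'] c(2)[of C C'] by linarith
      qed
    qed
  qed
qed

section \<open>Level sets and their stability under small perturbations in L1\<close>

lemma nonconstant_level:
  fixes f :: "'a \<Rightarrow> real"
  assumes f: "integrable M f" and nc: "\<not> (AE x in M. f x = expectation f)"
  obtains t where "0 < prob {x \<in> space M. f x < t}" "prob {x \<in> space M. f x < t} < 1"
    "prob {x \<in> space M. f x = t} = 0"
proof -
  have [measurable]: "f \<in> borel_measurable M" using f by simp
  let ?m = "expectation f"
  \<comment> \<open>A function that is nowhere below its mean, up to a null set, equals it. Letting
    1 / (n + 1) tend to 0 then yields a level s strictly below the mean with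
    \<open>f \<le> s\<close> on a set of positive measure.\<close>
  have "\<not> (AE x in M. ?m \<le> f x)"
  proof
    assume ge: "AE x in M. ?m \<le> f x"
    have "expectation (\<lambda>x. f x - ?m) = 0" using f by (simp add: prob_space)
    then have "AE x in M. f x - ?m = 0"
      using f ge by (subst (asm) integral_nonneg_eq_0_iff_AE) auto
    then show False using nc by simp
  qed
  moreover have "AE x in M. ?m \<le> f x" if "\<And>n. AE x in M. ?m - 1 / Suc n < f x"
  proof -
    have "AE x in M. \<forall>n. ?m - 1 / Suc n < f x" using that by (simp add: AE_all_countable)
    then show ?thesis
    proof eventually_elim
      case (elim x)
      have "(\<lambda>n. ?m - 1 / Suc n) \<longlonglongrightarrow> ?m - 0"
        by (intro tendsto_intros LIMSEQ_inverse_real_of_nat[unfolded inverse_eq_divide])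
      then show ?case using elim by (auto intro: LIMSEQ_le_const2 less_imp_le)
    qed
  qed
  ultimately obtain n where n: "\<not> (AE x in M. ?m - 1 / Suc n < f x)" by blast
  define s where "s = ?m - 1 / Suc n"
  have s: "s < ?m" by (simp add: s_def)
  have pos_s: "0 < prob {x \<in> space M. f x \<le> s}"
  proof (rule ccontr)
    assume "\<not> ?thesis"
    then have "prob {x \<in> space M. f x \<le> s} = 0" by (simp add: not_less measure_le_0_iff)
    then have "AE x in M. \<not> f x \<le> s"
      by (subst AE_iff_measurable[OF _ refl]) (auto simp: emeasure_eq_measure)
    then show False using n by (simp add: s_def not_le)
  qed
  have pos_m: "0 < prob {x \<in> space M. ?m \<le> f x}"
  proof (rule ccontr)
    assume "\<not> ?thesis"
    then have "prob {x \<in> space M. ?m \<le> f x} = 0" by (simp add: not_less measure_le_0_iff)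
    then have "AE x in M. \<not> ?m \<le> f x"
      by (subst AE_iff_measurable[OF _ refl]) (auto simp: emeasure_eq_measure)
    then have "AE x in M. f x < ?m" by (simp add: not_le)
    then have "?m < expectation (\<lambda>_. ?m)"
      using f by (intro integral_less_AE_space) (auto simp: emeasure_space_1)
    then show False by (simp add: prob_space)
  qed
  \<comment> \<open>The distribution of f has only countably many atoms, so some t strictly between
    s and the mean is not one of them.\<close>
  interpret D: finite_measure "distr M borel f" by (rule finite_measure_distr) simp
  have "countable {t. measure (distr M borel f) {t} \<noteq> 0}" by (rule D.countable_support)
  moreover have "uncountable {s<..<?m}" using s by (simp add: uncountable_open_interval)
  ultimately have "\<not> {s<..<?m} \<subseteq> {t. measure (distr M borel f) {t} \<noteq> 0}"
    using countable_subset by blast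
  then obtain t where t: "s < t" "t < ?m" "measure (distr M borel f) {t} = 0" by auto
  have "prob {x \<in> space M. f x = t} = 0"
    using t(3) by (simp add: measure_distr vimage_def Int_def conj_commute)
  moreover have "0 < prob {x \<in> space M. f x < t}"
    using pos_s by (rule less_le_trans) (intro finite_measure_mono, use t in auto)
  moreover have "prob {x \<in> space M. f x < t} \<le> prob (space M - {x \<in> space M. ?m \<le> f x})"
    by (intro finite_measure_mono) (use t in auto)
  then have "prob {x \<in> space M. f x < t} < 1"
    using pos_m by (subst (asm) prob_compl) auto
  ultimately show thesis using that by blast
qed

text \<open>Where the level sets of \<open>f i\<close> and \<open>f j\<close> differ, either
  \<open>f i\<close> is within \<delta> of t or the two functions differ by at least \<delta>. The
  first event is uniformly small by assumption; the second is small by Markov's inequality, once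
  labels ensure an L1 distance of at most \<open>\<delta> * (\<epsilon> / 2)\<close>.\<close>

lemma finitely_labelled_level_sets:
  fixes f :: "'i \<Rightarrow> 'a \<Rightarrow> real"
  assumes int: "\<And>i. i \<in> I \<Longrightarrow> integrable M (f i)"
    and lab: "finitely_labelled I (\<lambda>i j. expectation (\<lambda>x. \<bar>f i x - f j x\<bar>))"
    and unif: "\<And>\<epsilon>. 0 < \<epsilon> \<Longrightarrow> \<exists>\<delta>>0. \<forall>i\<in>I. prob {x \<in> space M. \<bar>f i x - t\<bar> < \<delta>} \<le> \<epsilon>"
  shows "finitely_labelled I (\<lambda>i j. prob (sym_diff {x \<in> space M. f i x < t} {x \<in> space M. f j x < t}))"
  unfolding finitely_labelled_def
proof (intro allI impI)
  fix \<epsilon> :: real assume \<epsilon>: "0 < \<epsilon>"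
  then obtain \<delta> where \<delta>: "0 < \<delta>" "\<And>i. i \<in> I \<Longrightarrow> prob {x \<in> space M. \<bar>f i x - t\<bar> < \<delta>} \<le> \<epsilon> / 2"
    using unif[of "\<epsilon> / 2"] by auto
  have "0 < \<delta> * (\<epsilon> / 2)" using \<epsilon> \<delta>(1) by simp
  obtain c :: "_ \<Rightarrow> nat" where "finite (c ` I)"
        "\<forall>i\<in>I. \<forall>j\<in>I. c i = c j \<longrightarrow> expectation (\<lambda>x. \<bar>f i x - f j x\<bar>) \<le> \<delta> * (\<epsilon> / 2)"
      using finitely_labelledD[OF lab \<open>0 < \<delta> * (\<epsilon> / 2)\<close>] by blast
    note c = this(1) this(2)[rule_format]
  show "\<exists>c :: 'i \<Rightarrow> nat. finite (c ` I) \<and> (\<forall>i\<in>I. \<forall>j\<in>I. c i = c j \<longrightarrow>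
      prob (sym_diff {x \<in> space M. f i x < t} {x \<in> space M. f j x < t}) \<le> \<epsilon>)"
  proof (intro exI[of _ c] conjI ballI impI c(1))
    fix i j assume ij: "i \<in> I" "j \<in> I" "c i = c j"
    have [measurable]: "f i \<in> borel_measurable M" "f j \<in> borel_measurable M"
      using int ij by auto
    have "prob {x \<in> space M. \<delta> \<le> \<bar>f i x - f j x\<bar>} \<le> expectation (\<lambda>x. \<bar>f i x - f j x\<bar>) / \<delta>"
      using \<delta>(1) int ij by (intro integral_Markov_inequality_measure[where A = "space M"]) auto
    also have "\<dots> \<le> \<epsilon> / 2" using c(2)[OF ij] \<delta>(1) by (simp add: field_simps)
    finally have *: "prob {x \<in> space M. \<delta> \<le> \<bar>f i x - f j x\<bar>} \<le> \<epsilon> / 2" .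
    have "prob (sym_diff {x \<in> space M. f i x < t} {x \<in> space M. f j x < t}) \<le>
        prob ({x \<in> space M. \<bar>f i x - t\<bar> < \<delta>} \<union> {x \<in> space M. \<delta> \<le> \<bar>f i x - f j x\<bar>})"
      by (intro finite_measure_mono) auto
    also have "\<dots> \<le> prob {x \<in> space M. \<bar>f i x - t\<bar> < \<delta>} + prob {x \<in> space M. \<delta> \<le> \<bar>f i x - f j x\<bar>}"
      by (intro measure_Un_le) auto
    finally show "prob (sym_diff {x \<in> space M. f i x < t} {x \<in> space M. f j x < t}) \<le> \<epsilon>"
      using * \<delta>(2)[OF ij(1)] by linarith
  qed
qed

text \<open>The neighbourhoods shrink to the null set \<open>f = t\<close>, and the measure is
  continuous from above.\<close>

lemma level_neighbourhood_small:
  fixes f :: "'a \<Rightarrow> real"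
  assumes [measurable]: "f \<in> borel_measurable M" and "prob {x \<in> space M. f x = t} = 0" "0 < \<epsilon>"
  shows "\<exists>\<delta>>0. prob {x \<in> space M. \<bar>f x - t\<bar> < \<delta>} \<le> \<epsilon>"
proof -
  let ?A = "\<lambda>n. {x \<in> space M. \<bar>f x - t\<bar> < 1 / Suc n}"
  have eq: "(\<Inter>n. ?A n) = {x \<in> space M. f x = t}"
  proof (intro equalityI subsetI)
    fix x assume x: "x \<in> (\<Inter>n. ?A n)"
    have "(\<lambda>n. 1 / real (Suc n)) \<longlonglongrightarrow> 0"
      by (rule LIMSEQ_inverse_real_of_nat[unfolded inverse_eq_divide])
    then have "\<bar>f x - t\<bar> \<le> 0"
      using x by (intro LIMSEQ_le_const) (auto intro: less_imp_le)
    then show "x \<in> {x \<in> space M. f x = t}" using x by auto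
  qed auto
  have "decseq ?A"
    unfolding decseq_def
  proof (intro allI impI subsetI)
    fix m n :: nat and x assume "m \<le> n" "x \<in> ?A n"
    moreover from this have "1 / real (Suc n) \<le> 1 / real (Suc m)" by (intro frac_le) auto
    ultimately show "x \<in> ?A m" by auto
  qed
  then have "(\<lambda>n. prob (?A n)) \<longlonglongrightarrow> prob (\<Inter>n. ?A n)"
    by (intro finite_Lim_measure_decseq) auto
  then have "(\<lambda>n. prob (?A n)) \<longlonglongrightarrow> 0" unfolding eq using assms(2) by simp
  from order_tendstoD(2)[OF this \<open>0 < \<epsilon>\<close>] obtain n where "prob (?A n) < \<epsilon>"
    by (auto simp: eventually_sequentially)
  then show ?thesis by (intro exI[of _ "1 / Suc n"]) auto
qed

end

section \<open>Weak mixing yields asymptotic independence\<close>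

context G_MPS
begin

section \<open>The action as measure-preserving surjections\<close>

lemma group_G: "group G"
  using group_hom group_hom.axioms(1) by blast

lemma space_M: "space M = UNIV"
  using sets_eq_imp_space_eq[OF sets_M] by simp

lemma measurable_act: "g \<in> carrier G \<Longrightarrow> act g \<in> measurable M M"
  using borel_measurable_continuous_onI[OF continuous_act]
  by (simp cong: measurable_cong_sets add: sets_M)

lemma sets_vimage_act: "g \<in> carrier G \<Longrightarrow> A \<in> sets M \<Longrightarrow> act g -` A \<in> sets M"
  using measurable_sets[OF measurable_act] by (simp add: space_M)

lemma prob_vimage_act: "g \<in> carrier G \<Longrightarrow> A \<in> sets M \<Longrightarrow> prob (act g -` A) = prob A"
  using invariant_M[of g A] by (simp add: measure_def space_M)

lemma distr_act: "g \<in> carrier G \<Longrightarrow> distr M M (act g) = M"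
  by (rule measure_eqI) (simp_all add: emeasure_distr measurable_act invariant_M)

lemma act_mult: "g \<in> carrier G \<Longrightarrow> h \<in> carrier G \<Longrightarrow> act (g \<otimes> h) x = act g (act h x)"
  using composition_rule[of x g h] by simp

lemma act_one: "act \<one> x = x"
  using fun_cong[OF id_eq_one, of x] by simp

lemma surj_act: "g \<in> carrier G \<Longrightarrow> surj (act g)"
  using surj_prop by simp

section \<open>The diagonal action on the product and correlations\<close>

sublocale pair: pair_prob_space M M ..

abbreviation diag_act :: "'g \<Rightarrow> 'x \<times> 'x \<Rightarrow> 'x \<times> 'x" where
  "diag_act g \<equiv> (\<lambda>(x, y). (act g x, act g y))"

lemma measure_preserving_diag_act:
  assumes "countable (carrier G)"
  shows "measure_preserving_action G (M \<Otimes>\<^sub>M M) diag_act"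
proof -
  interpret G: group G by (rule group_G)
  show ?thesis
  proof unfold_locales
    fix g assume g: "g \<in> carrier G"
    note [measurable] = measurable_act[OF g]
    show "diag_act g \<in> measurable (M \<Otimes>\<^sub>M M) (M \<Otimes>\<^sub>M M)" by measurable
    have "sigma_finite_measure (distr M M (act g))"
      unfolding distr_act[OF g] by (rule sigma_finite_measure_axioms)
    from pair_measure_distr[OF measurable_act[OF g] measurable_act[OF g] this]
    show "distr (M \<Otimes>\<^sub>M M) (M \<Otimes>\<^sub>M M) (diag_act g) = M \<Otimes>\<^sub>M M"
      by (simp only: distr_act[OF g])
  next
    fix g h and z :: "'x \<times> 'x" assume "g \<in> carrier G" "h \<in> carrier G"
    then show "diag_act (g \<otimes> h) z = diag_act g (diag_act h z)"
      by (cases z) (simp add: act_mult)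
  next
    show "diag_act \<one> z = z" for z by (cases z) (simp add: act_one)
  qed (fact assms)
qed

text \<open>Fubini's theorem. The square makes correlations on the product nonnegative, so that a
  bound on their sum bounds each of them.\<close>

lemma expectation_tensor_square:
  fixes h :: "'x \<Rightarrow> real"
  assumes [measurable]: "h \<in> borel_measurable M" and bd: "\<And>x. \<bar>h x\<bar> \<le> 1"
  shows "pair.expectation (\<lambda>z. h (fst z) * h (snd z)) = (expectation h)\<^sup>2"
proof -
  have "\<bar>h x * h y\<bar> \<le> 1" for x y
    using mult_mono[OF bd[of x] bd[of y]] by (simp add: abs_mult)
  then have "integrable (M \<Otimes>\<^sub>M M) (\<lambda>z. h (fst z) * h (snd z))"
    by (intro pair.integrable_const_bound[where B = 1]) auto
  from pair.integral_fst'[OF this] show ?thesis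
    by (simp add: power2_eq_square)
qed

text \<open>With f the centred indicator of \<open>A i\<close> and k the indicator of
  \<open>B i\<close>, the correlation of f(x) f(y), moved by the diagonal action, with k(x) k(y) is
  the square of the deviation from independence. Ergodicity of the product makes the sum of these
  squares less than the square of \<epsilon>.\<close>

lemma exists_almost_independent_aux:
  assumes "countable (carrier G)" and wm: "weakly_mixing G act M" and I: "finite I"
    and A: "\<And>i. i \<in> I \<Longrightarrow> A i \<in> sets M" and B: "\<And>i. i \<in> I \<Longrightarrow> B i \<in> sets M" and "0 < \<epsilon>"
  shows "\<exists>g\<in>carrier G. \<forall>i\<in>I. \<bar>prob (act g -` A i \<inter> B i) - prob (A i) * prob (B i)\<bar> < \<epsilon>"
proof -
  interpret P: measure_preserving_action G "M \<Otimes>\<^sub>M M" diag_act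
    by (rule measure_preserving_diag_act) fact
  \<comment> \<open>Extended by 0 outside \<open>I\<close>, since
    \<open>exists_small_correlation\<close> asks for measurability and bounds at every
    index.\<close>
  define f where "f i x = (if i \<in> I then indicator (A i) x - prob (A i) else 0 :: real)" for i x
  define k where "k i x = (if i \<in> I then indicator (B i) x else 0 :: real)" for i x
  have f [measurable]: "f i \<in> borel_measurable M" for i
    unfolding f_def using A by (cases "i \<in> I") auto
  have k [measurable]: "k i \<in> borel_measurable M" for i
    unfolding k_def using B by (cases "i \<in> I") auto
  have f_bd: "\<bar>f i x\<bar> \<le> 1" for i x
    using prob_le_1[of "A i"] by (auto simp: f_def indicator_def)
  have k_bd: "\<bar>k i x\<bar> \<le> 1" for i x
    by (auto simp: k_def indicator_def)
  have mult_le_1: "\<bar>a * b\<bar> \<le> 1" if "\<bar>a\<bar> \<le> 1" "\<bar>b\<bar> \<le> 1" for a b :: real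
    using mult_mono[OF that] by (simp add: abs_mult)
  have mean: "expectation (f i) = 0" if "i \<in> I" for i
  proof -
    have "expectation (f i) = expectation (\<lambda>x. indicator (A i) x - prob (A i))"
      using that by (intro Bochner_Integration.integral_cong) (simp_all add: f_def)
    then show ?thesis using A[OF that] by (simp add: prob_space less_top[symmetric])
  qed
  have "\<exists>g\<in>carrier G. (\<Sum>i\<in>I. pair.expectation
      (\<lambda>z. f i (fst (diag_act g z)) * f i (snd (diag_act g z)) * (k i (fst z) * k i (snd z)))) < \<epsilon>\<^sup>2"
    using wm \<open>0 < \<epsilon>\<close> I unfolding weakly_mixing_def
    by (intro P.exists_small_correlation)
       (auto simp: expectation_tensor_square f_bd k_bd mult_le_1 mean)
  then obtain g where g: "g \<in> carrier G" and small: "(\<Sum>i\<in>I. pair.expectation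
      (\<lambda>z. f i (fst (diag_act g z)) * f i (snd (diag_act g z)) * (k i (fst z) * k i (snd z)))) < \<epsilon>\<^sup>2"
    by blast
  have corr: "pair.expectation (\<lambda>z. f i (fst (diag_act g z)) * f i (snd (diag_act g z)) * (k i (fst z) * k i (snd z))) =
      (prob (act g -` A i \<inter> B i) - prob (A i) * prob (B i))\<^sup>2" if i: "i \<in> I" for i
  proof -
    note [measurable] = measurable_act[OF g]
    have "pair.expectation (\<lambda>z. f i (fst (diag_act g z)) * f i (snd (diag_act g z)) * (k i (fst z) * k i (snd z))) =
        pair.expectation (\<lambda>z. (f i (act g (fst z)) * k i (fst z)) * (f i (act g (snd z)) * k i (snd z)))"
      by (intro Bochner_Integration.integral_cong) (auto simp: case_prod_unfold)
    also have "\<dots> = (expectation (\<lambda>x. f i (act g x) * k i x))\<^sup>2"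
      by (rule expectation_tensor_square) (auto intro: mult_le_1 f_bd k_bd)
    also have "(\<lambda>x. f i (act g x) * k i x) =
        (\<lambda>x. indicator (act g -` A i \<inter> B i) x - prob (A i) * indicator (B i) x)"
      using i by (auto simp: f_def k_def indicator_def fun_eq_iff)
    also have "expectation \<dots> = prob (act g -` A i \<inter> B i) - prob (A i) * prob (B i)"
      using A[OF i] B[OF i] sets_vimage_act[OF g A[OF i]] by (simp add: less_top[symmetric])
    finally show ?thesis .
  qed
  have "(prob (act g -` A i \<inter> B i) - prob (A i) * prob (B i))\<^sup>2 < \<epsilon>\<^sup>2" if i: "i \<in> I" for i
  proof -
    have "(prob (act g -` A i \<inter> B i) - prob (A i) * prob (B i))\<^sup>2 \<le>
        (\<Sum>i\<in>I. (prob (act g -` A i \<inter> B i) - prob (A i) * prob (B i))\<^sup>2)"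
      using I i by (intro member_le_sum) auto
    also have "\<dots> < \<epsilon>\<^sup>2" using small corr by simp
    finally show ?thesis .
  qed
  then have "\<forall>i\<in>I. \<bar>prob (act g -` A i \<inter> B i) - prob (A i) * prob (B i)\<bar> < \<epsilon>"
    using \<open>0 < \<epsilon>\<close> by (metis abs_of_pos power2_abs power2_less_imp_less less_imp_le)
  with g show ?thesis by blast
qed

text \<open>A set \<open>A\<close> of measure strictly between 0 and 1 is not independent of itself, so adding the pairs
  of \<open>A\<close> and \<open>act d -` A\<close> for \<open>d \<in> D\<close> to the family keeps \<open>g\<close> away from \<open>D\<close>.\<close>
lemma exists_almost_independent:
  fixes A B :: "'i \<Rightarrow> 'x set"
  assumes "countable (carrier G)" "infinite (carrier G)" and wm: "weakly_mixing G act M"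
    and I: "finite I" and A: "\<And>i. i \<in> I \<Longrightarrow> A i \<in> sets M" and B: "\<And>i. i \<in> I \<Longrightarrow> B i \<in> sets M"
    and "0 < \<epsilon>" and D: "finite D"
  shows "\<exists>g\<in>carrier G - D. \<forall>i\<in>I. \<bar>prob (act g -` A i \<inter> B i) - prob (A i) * prob (B i)\<bar> < \<epsilon>"
proof (cases "\<exists>i\<in>I. prob (A i) \<noteq> 0 \<and> prob (A i) \<noteq> 1")
  case True
  then obtain j where j: "j \<in> I" "prob (A j) \<noteq> 0" "prob (A j) \<noteq> 1" by blast
  define a where "a = prob (A j)"
  have a: "0 < a" "a < 1" using j by (simp_all add: a_def order_less_le)
  \<comment> \<open>\<open>Inl\<close> carries the given pairs, \<open>Inr\<close> the pairs that
    exclude elements of \<open>D\<close>.\<close>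
  define I' :: "('i + 'g) set" where "I' = Inl ` I \<union> Inr ` (D \<inter> carrier G)"
  define A' :: "'i + 'g \<Rightarrow> 'x set" where "A' = case_sum A (\<lambda>_. A j)"
  define B' :: "'i + 'g \<Rightarrow> 'x set" where "B' = case_sum B (\<lambda>d. act d -` A j)"
  \<comment> \<open>The deviation of a set of measure a from independence of itself is
    \<open>a - a * a\<close>, which is what g in \<open>D\<close> would produce.\<close>
  define \<epsilon>' where "\<epsilon>' = min \<epsilon> (a - a * a)"
  have "a * a < a" using a by simp
  then have "0 < \<epsilon>'" using \<open>0 < \<epsilon>\<close> by (simp add: \<epsilon>'_def)
  moreover have "finite I'" using I D by (simp add: I'_def)
  moreover have "A' i \<in> sets M" "B' i \<in> sets M" if "i \<in> I'" for i
    using that A B j sets_vimage_act by (auto simp: I'_def A'_def B'_def)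
  ultimately obtain g where g: "g \<in> carrier G"
    "\<forall>i\<in>I'. \<bar>prob (act g -` A' i \<inter> B' i) - prob (A' i) * prob (B' i)\<bar> < \<epsilon>'"
    using exists_almost_independent_aux[OF assms(1) wm, of I' A' B' \<epsilon>'] by blast
  have "g \<notin> D"
  proof
    assume "g \<in> D"
    then have "Inr g \<in> I'" using g(1) by (simp add: I'_def)
    then have "\<bar>prob (act g -` A j \<inter> act g -` A j) - prob (A j) * prob (act g -` A j)\<bar> < \<epsilon>'"
      using g(2) by (fastforce simp: A'_def B'_def)
    then show False
      using \<open>a * a < a\<close> prob_vimage_act[OF g(1) A[OF j(1)]] by (simp add: \<epsilon>'_def a_def)
  qed
  moreover have "\<bar>prob (act g -` A i \<inter> B i) - prob (A i) * prob (B i)\<bar> < \<epsilon>" if "i \<in> I" for i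
  proof -
    have "Inl i \<in> I'" using that by (simp add: I'_def)
    from bspec[OF g(2) this] show ?thesis by (simp add: A'_def B'_def \<epsilon>'_def)
  qed
  ultimately show ?thesis using g(1) by blast
next
  case False
  \<comment> \<open>Sets of measure 0 or 1 are independent of every set, so any g outside
    \<open>D\<close> works with deviation 0.\<close>
  obtain g where g: "g \<in> carrier G" "g \<notin> D"
    using \<open>infinite (carrier G)\<close> D by (metis finite_subset subsetI)
  have "prob (act g -` A i \<inter> B i) = prob (A i) * prob (B i)" if i: "i \<in> I" for i
  proof -
    note meas = sets_vimage_act[OF g(1) A[OF i]] B[OF i]
    have eq: "prob (act g -` A i) = prob (A i)" by (rule prob_vimage_act[OF g(1) A[OF i]])
    consider "prob (A i) = 0" | "prob (A i) = 1" using False i by blast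
    then show ?thesis
    proof cases
      case 1
      have "prob (act g -` A i \<inter> B i) \<le> prob (act g -` A i)"
        using meas by (intro finite_measure_mono) auto
      then show ?thesis using eq 1 by (simp add: measure_le_0_iff)
    next
      case 2
      have "prob (B i) = prob (act g -` A i \<inter> B i) + prob (B i - act g -` A i)"
        using meas by (subst finite_measure_Union[symmetric]) (auto intro!: arg_cong[where f = prob])
      moreover have "prob (B i - act g -` A i) \<le> prob (space M - act g -` A i)"
        by (intro finite_measure_mono sets.compl_sets meas) (auto simp: space_M)
      moreover have "prob (space M - act g -` A i) = 0"
        using meas eq 2 by (subst prob_compl) auto
      ultimately show ?thesis using 2 measure_nonneg[of M "B i - act g -` A i"] by simp
    qed
  qed
  then show ?thesis using g \<open>0 < \<epsilon>\<close> by (intro bexI[of _ g]) simp_all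
qed

section \<open>Almost additive entropy and the construction of the set \<open>S\<close>\<close>

lemma sum_preimage_partition:
  assumes "g \<in> carrier G"
  shows "(\<Sum>C\<in>preimage_partition M (act g) \<alpha>. f C) = (\<Sum>A\<in>\<alpha>. f (act g -` A))"
proof -
  have "inj_on (\<lambda>A. act g -` A) \<alpha>"
    using surj_image_vimage_eq[OF surj_act[OF assms]] by (intro inj_on_inverseI)
  then show ?thesis
    unfolding preimage_partition_def space_M by (simp add: sum.reindex)
qed

text \<open>Surjectivity of \<open>act g\<close> keeps the preimages of nonempty cells nonempty, as
  \<open>partition_on\<close> requires.\<close>

lemma finite_partition_preimage:
  assumes g: "g \<in> carrier G" and \<alpha>: "finite_measurable_partition M \<alpha>"
  shows "finite_measurable_partition M (preimage_partition M (act g) \<alpha>)"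
proof (rule finite_partitionI)
  have eq: "preimage_partition M (act g) \<alpha> = (\<lambda>A. act g -` A) ` \<alpha>"
    by (simp add: preimage_partition_def space_M)
  show "finite (preimage_partition M (act g) \<alpha>)" using finite_partitionD(1)[OF \<alpha>] by (simp add: eq)
  have "\<Union>(preimage_partition M (act g) \<alpha>) = act g -` \<Union>\<alpha>" unfolding eq by blast
  then show "\<Union>(preimage_partition M (act g) \<alpha>) = space M" using finite_partitionD(3)[OF \<alpha>] by (simp add: space_M)
  have "act g -` A \<noteq> {}" if "A \<noteq> {}" for A using surj_act[OF g] that by (simp add: surj_vimage_empty)
  then show "{} \<notin> preimage_partition M (act g) \<alpha>"
    using finite_partitionD(4)[OF \<alpha>] unfolding eq by (metis imageE)
  fix C assume "C \<in> preimage_partition M (act g) \<alpha>"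
  then obtain A where A: "A \<in> \<alpha>" "C = act g -` A" unfolding eq by blast
  then show "C \<in> sets M" using finite_partitionD(2)[OF \<alpha>] sets_vimage_act[OF g] by blast
  fix C' assume "C' \<in> preimage_partition M (act g) \<alpha>" "C \<noteq> C'"
  then obtain A' where A': "A' \<in> \<alpha>" "C' = act g -` A'" "A \<noteq> A'" using A unfolding eq by blast
  show "C \<inter> C' = {}" using finite_partitionD(5)[OF \<alpha> A(1) A'(1,3)] unfolding A(2) A'(2) by blast
qed

text \<open>Under exact independence \<open>eta_mult\<close> would make the entropies add. Uniform
  continuity of \<open>eta\<close> carries near independence of the cells over to the entropies. One
  g serves all partitions in the family because only finitely many pairs of cells occur.\<close>

lemma exists_almost_additive:
  assumes "countable (carrier G)" "infinite (carrier G)" "weakly_mixing G act M"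
    and \<alpha>: "finite_measurable_partition M \<alpha>"
    and fin: "finite \<Q>" and fmp: "\<And>Q. Q \<in> \<Q> \<Longrightarrow> finite_measurable_partition M Q"
    and "finite D" "0 < \<delta>"
  shows "\<exists>g\<in>carrier G - D. \<forall>Q\<in>\<Q>.
    \<bar>(\<Sum>p\<in>Q. \<Sum>C\<in>preimage_partition M (act g) \<alpha>. eta (prob (p \<inter> C)))
      - partition_entropy M Q - partition_entropy M \<alpha>\<bar> \<le> \<delta>"
proof -
  \<comment> \<open>Bounds the number of pairs of cells for each Q at once, so that an error of
    \<open>\<delta> / N\<close> per pair suffices; the added 1 keeps it positive.\<close>
  define N where "N = (\<Sum>Q\<in>\<Q>. real (card Q * card \<alpha>)) + 1"
  have "0 \<le> (\<Sum>Q\<in>\<Q>. real (card Q * card \<alpha>))" by (intro sum_nonneg) simp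
  then have N: "0 < N" by (simp add: N_def)
  then obtain d where d: "0 < d" "\<And>s t. 0 \<le> s \<Longrightarrow> s \<le> 1 \<Longrightarrow> 0 \<le> t \<Longrightarrow> t \<le> 1 \<Longrightarrow> \<bar>s - t\<bar> < d \<Longrightarrow> \<bar>eta s - eta t\<bar> < \<delta> / N"
    using eta_uniformly_continuous[of "\<delta> / N"] \<open>0 < \<delta>\<close> by (metis divide_pos_pos)
  have fin': "finite (\<alpha> \<times> \<Union>\<Q>)"
    using fin finite_partitionD(1)[OF \<alpha>] finite_partitionD(1)[OF fmp] by simp
  have "fst i \<in> sets M" "snd i \<in> sets M" if "i \<in> \<alpha> \<times> \<Union>\<Q>" for i
    using that finite_partitionD(2)[OF \<alpha>] finite_partitionD(2)[OF fmp] by (auto simp: mem_Times_iff)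
  from exists_almost_independent[OF assms(1-3) fin' this d(1) \<open>finite D\<close>]
  obtain g where g: "g \<in> carrier G - D"
    "\<forall>i\<in>\<alpha> \<times> \<Union>\<Q>. \<bar>prob (act g -` fst i \<inter> snd i) - prob (fst i) * prob (snd i)\<bar> < d"
    by (rule bexE)
  have "\<bar>(\<Sum>p\<in>Q. \<Sum>C\<in>preimage_partition M (act g) \<alpha>. eta (prob (p \<inter> C)))
      - partition_entropy M Q - partition_entropy M \<alpha>\<bar> \<le> \<delta>" if Q: "Q \<in> \<Q>" for Q
  proof -
    have total: "(\<Sum>p\<in>P. prob p) = 1" if "finite_measurable_partition M P" for P
      using prob_sum_partition[OF that, of "space M"] finite_partitionD(2)[OF that] by (simp add: prob_space)
    have "(\<Sum>p\<in>Q. \<Sum>A\<in>\<alpha>. eta (prob p * prob A)) =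
        (\<Sum>p\<in>Q. prob p * (\<Sum>A\<in>\<alpha>. eta (prob A)) + (\<Sum>A\<in>\<alpha>. prob A) * eta (prob p))"
      by (simp add: eta_mult sum.distrib sum_distrib_left sum_distrib_right)
    also have "\<dots> = partition_entropy M Q + partition_entropy M \<alpha>"
      by (simp add: total[OF \<alpha>] total[OF fmp[OF Q]] sum.distrib sum_distrib_right[symmetric]
          partition_entropy_eta)
    finally have indep: "partition_entropy M Q + partition_entropy M \<alpha> =
        (\<Sum>p\<in>Q. \<Sum>A\<in>\<alpha>. eta (prob p * prob A))" by simp
    have "(\<Sum>p\<in>Q. \<Sum>C\<in>preimage_partition M (act g) \<alpha>. eta (prob (p \<inter> C)))
        - partition_entropy M Q - partition_entropy M \<alpha> =
        (\<Sum>p\<in>Q. \<Sum>A\<in>\<alpha>. eta (prob (p \<inter> act g -` A)) - eta (prob p * prob A))"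
      using g(1) indep by (simp add: sum_preimage_partition sum_subtractf)
    also have "\<bar>\<dots>\<bar> \<le> (\<Sum>p\<in>Q. \<Sum>A\<in>\<alpha>. \<delta> / N)"
    proof (intro order_trans[OF sum_abs] sum_mono order_trans[OF sum_abs])
      fix p A assume pA: "p \<in> Q" "A \<in> \<alpha>"
      then have "(A, p) \<in> \<alpha> \<times> \<Union>\<Q>" using Q by blast
      from bspec[OF g(2) this] show "\<bar>eta (prob (p \<inter> act g -` A)) - eta (prob p * prob A)\<bar> \<le> \<delta> / N"
        by (intro less_imp_le[OF d(2)]) (simp_all add: mult_le_one Int_commute mult.commute)
    qed
    also have "\<dots> = real (card Q * card \<alpha>) * (\<delta> / N)" by simp
    also have "\<dots> \<le> N * (\<delta> / N)"
    proof (rule mult_right_mono)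
      have "real (card Q * card \<alpha>) \<le> (\<Sum>Q\<in>\<Q>. real (card Q * card \<alpha>))"
        using fin Q by (intro member_le_sum) auto
      then show "real (card Q * card \<alpha>) \<le> N" by (simp add: N_def)
    qed (use N \<open>0 < \<delta>\<close> in simp)
    also have "\<dots> = \<delta>" using N by simp
    finally show ?thesis .
  qed
  then show ?thesis using g(1) by blast
qed

end

text \<open>Any finite subset of \<open>S\<close> is contained in some \<open>F n\<close>, hence in
  all later ones.\<close>

lemma card_Int_tendsto_infinity:
  assumes "infinite S" "incseq F" "S \<subseteq> (\<Union>n. F n)" "\<And>n. finite (F n)"
  shows "filterlim (\<lambda>n. card (S \<inter> F n)) at_top sequentially"
  unfolding filterlim_at_top
proof
  fix N :: nat
  obtain T where T: "T \<subseteq> S" "finite T" "card T = N"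
    using infinite_arbitrarily_large[OF assms(1)] by blast
  have "\<exists>n. T \<subseteq> F n" if "finite T" "T \<subseteq> (\<Union>n. F n)" for T
    using that
  proof (induction T)
    case (insert x T)
    then obtain n m where "T \<subseteq> F n" "x \<in> F m" by blast
    moreover have "F n \<subseteq> F (max n m)" "F m \<subseteq> F (max n m)"
      using \<open>incseq F\<close> by (simp_all add: incseq_def)
    ultimately show ?case by blast
  qed simp
  then obtain n where n: "T \<subseteq> F n" using T assms(3) by blast
  show "\<forall>\<^sub>F n in sequentially. N \<le> card (S \<inter> F n)"
    unfolding eventually_sequentially
  proof (intro exI allI impI)
    fix m assume "n \<le> m"
    then have "F n \<subseteq> F m" using \<open>incseq F\<close> by (simp add: incseq_def)
    then have "T \<subseteq> S \<inter> F m" using n T(1) by blast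
    then show "N \<le> card (S \<inter> F m)" using T(3) card_mono[of "S \<inter> F m" T] assms(4) by simp
  qed
qed

text \<open>The sets \<open>S \<inter> F n\<close> need not be initial segments in the order of
  choice, so each new element is made almost independent of the joins over all subsets of the
  earlier ones. Errors \<open>(1/2) ^ n\<close> add up to at most 2, which vanishes after division
  by the number of elements.\<close>

lemma (in G_MPS) weakly_mixing_imp_full_entropy:
  assumes G: "countable (carrier G)" "infinite (carrier G)" "weakly_mixing G act M"
    and F: "\<And>n. finite (F n)" "incseq F" "(\<Union>n. F n) = carrier G"
    and \<alpha>: "finite_measurable_partition M \<alpha>"
  shows "\<exists>S\<subseteq>carrier G. infinite S \<and> seq_entropy act M F S \<alpha> = ereal (partition_entropy M \<alpha>)"
proof -
  define H where "H E = partition_entropy M (join_partitions M E (\<lambda>g. preimage_partition M (act g) \<alpha>))" for E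
  define h where "h = partition_entropy M \<alpha>"
  \<comment> \<open>The conditions on \<open>D\<close> stand inside the existential, so that
    \<open>SOME\<close> defines a total function of n and \<open>D\<close>.\<close>
  have "\<exists>g. finite D \<and> D \<subseteq> carrier G \<longrightarrow>
      g \<in> carrier G - D \<and> (\<forall>E\<subseteq>D. \<bar>H (insert g E) - H E - h\<bar> \<le> (1/2) ^ n)" for n :: nat and D
  proof (cases "finite D \<and> D \<subseteq> carrier G")
    case True
    then have D: "finite D" "D \<subseteq> carrier G" by auto
    let ?J = "\<lambda>E. join_partitions M E (\<lambda>g. preimage_partition M (act g) \<alpha>)"
    have fmp: "finite_measurable_partition M (?J E)" if "E \<subseteq> D" for E
      using that D finite_subset[OF that] by (intro finite_partition_join finite_partition_preimage \<alpha>) auto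
    have "\<exists>g\<in>carrier G - D. \<forall>Q\<in>?J ` Pow D.
      \<bar>(\<Sum>p\<in>Q. \<Sum>C\<in>preimage_partition M (act g) \<alpha>. eta (prob (p \<inter> C)))
        - partition_entropy M Q - partition_entropy M \<alpha>\<bar> \<le> (1/2) ^ n"
      using D(1) fmp by (intro exists_almost_additive G \<alpha>) auto
    then obtain g where g: "g \<in> carrier G - D" "\<And>E. E \<subseteq> D \<Longrightarrow>
      \<bar>(\<Sum>p\<in>?J E. \<Sum>C\<in>preimage_partition M (act g) \<alpha>. eta (prob (p \<inter> C))) - H E - h\<bar> \<le> (1/2) ^ n"
      unfolding H_def h_def by blast
    have "H (insert g E) = (\<Sum>p\<in>?J E. \<Sum>C\<in>preimage_partition M (act g) \<alpha>. eta (prob (p \<inter> C)))"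
      if "E \<subseteq> D" for E
      unfolding H_def
    proof (rule partition_entropy_join_insert)
      show "finite E" using that D(1) by (rule finite_subset)
      show "g \<notin> E" using g(1) that by blast
      show "finite_measurable_partition M (preimage_partition M (act j) \<alpha>)" if "j \<in> insert g E" for j
        using that \<open>E \<subseteq> D\<close> D(2) g(1) by (intro finite_partition_preimage \<alpha>) auto
    qed
    then show ?thesis using g by (intro exI[of _ g]) simp
  qed blast
  note ex = this
  define nx where "nx n D = (SOME g. finite D \<and> D \<subseteq> carrier G \<longrightarrow>
      g \<in> carrier G - D \<and> (\<forall>E\<subseteq>D. \<bar>H (insert g E) - H E - h\<bar> \<le> (1/2) ^ n))" for n :: nat and D
  have "finite D \<and> D \<subseteq> carrier G \<longrightarrow> nx n D \<in> carrier G - D \<and>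
      (\<forall>E\<subseteq>D. \<bar>H (insert (nx n D) E) - H E - h\<bar> \<le> (1/2) ^ n)" for n D
    unfolding nx_def by (rule someI_ex[OF ex])
  then have nx: "finite D \<Longrightarrow> D \<subseteq> carrier G \<Longrightarrow> nx n D \<in> carrier G - D"
    "finite D \<Longrightarrow> D \<subseteq> carrier G \<Longrightarrow> E \<subseteq> D \<Longrightarrow> \<bar>H (insert (nx n D) E) - H E - h\<bar> \<le> (1/2) ^ n"
    for n D E by blast+
  define D where "D = rec_nat {} (\<lambda>n D. insert (nx n D) D)"
  have D_0: "D 0 = {}" and D_Suc: "D (Suc n) = insert (nx n (D n)) (D n)" for n
    by (simp_all add: D_def)
  have D: "finite (D n)" "D n \<subseteq> carrier G" "card (D n) = n" for n
  proof -
    have "finite (D n) \<and> D n \<subseteq> carrier G \<and> card (D n) = n"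
    proof (induction n)
      case (Suc n)
      then show ?case using nx(1)[of "D n" n] by (simp add: D_Suc)
    qed (simp add: D_0)
    then show "finite (D n)" "D n \<subseteq> carrier G" "card (D n) = n" by auto
  qed
  have "incseq D" by (rule incseq_SucI) (auto simp: D_Suc)
  have H_empty: "H {} = 0"
    using not_empty by (simp add: H_def join_partitions_empty partition_entropy_eta prob_space)
  \<comment> \<open>\<open>E\<close> is any subset of \<open>D n\<close>. If it contains the element
    chosen last, removing that element costs at most \<open>(1/2) ^ n\<close>; otherwise the
    previous stage applies directly.\<close>
  have H_bound: "\<bar>H E - card E * h\<bar> \<le> (\<Sum>i<n. (1/2) ^ i)" if "E \<subseteq> D n" for n E
    using that
  proof (induction n arbitrary: E)
    case 0
    then show ?case by (simp add: D_0 H_empty)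
  next
    case (Suc n)
    define g where "g = nx n (D n)"
    have g: "g \<notin> D n" using nx(1)[OF D(1,2), of n n] by (simp add: g_def)
    show ?case
    proof (cases "g \<in> E")
      case False
      then have "E \<subseteq> D n" using Suc.prems by (auto simp: D_Suc g_def)
      then have "\<bar>H E - card E * h\<bar> \<le> (\<Sum>i<n. (1/2) ^ i)" by (rule Suc.IH)
      then show ?thesis by (simp add: add_increasing2)
    next
      case True
      define E' where "E' = E - {g}"
      have E': "E' \<subseteq> D n" "E = insert g E'" "g \<notin> E'"
        using Suc.prems True unfolding E'_def D_Suc g_def by blast+
      then have "card E = Suc (card E')" using finite_subset[OF E'(1) D(1)] by simp
      then have "H E - card E * h = (H (insert g E') - H E' - h) + (H E' - card E' * h)"
        using E'(2) by (simp add: algebra_simps)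
      moreover have "\<bar>H (insert g E') - H E' - h\<bar> \<le> (1/2) ^ n"
        unfolding g_def using D(1,2) E'(1) by (rule nx(2))
      ultimately show ?thesis using Suc.IH[OF E'(1)] by simp
    qed
  qed
  have geometric: "(\<Sum>i<n. (1/2::real) ^ i) \<le> 2" for n
    using sum_le_suminf[of "\<lambda>i. (1/2::real) ^ i" "{..<n}"] by (simp add: summable_geometric suminf_geometric)
  define S where "S = (\<Union>n. D n)"
  have S: "S \<subseteq> carrier G" using D(2) by (auto simp: S_def)
  have "infinite S"
  proof
    assume "finite S"
    then have "card (D (Suc (card S))) \<le> card S" by (rule card_mono) (auto simp: S_def)
    then show False by (simp add: D(3))
  qed
  have bound: "\<bar>H E - card E * h\<bar> \<le> 2" if "finite E" "E \<subseteq> S" for E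
  proof -
    have "\<exists>n. E \<subseteq> D n"
      using that
    proof (induction E)
      case (insert x E)
      then obtain n m where "E \<subseteq> D n" "x \<in> D m" unfolding S_def by blast
      moreover have "D n \<subseteq> D (max n m)" "D m \<subseteq> D (max n m)"
        using \<open>incseq D\<close> by (simp_all add: incseq_def)
      ultimately show ?case by blast
    qed simp
    then show ?thesis using H_bound geometric order_trans by blast
  qed
  define c where "c n = card (S \<inter> F n)" for n
  have c: "filterlim (\<lambda>n. real (c n)) at_top sequentially"
    unfolding c_def
    by (rule filterlim_compose[OF filterlim_real_sequentially card_Int_tendsto_infinity])
       (use \<open>infinite S\<close> F S in auto)
  have "(\<lambda>n. 1 / real (c n) * H (S \<inter> F n)) \<longlonglongrightarrow> h"
  proof (rule LIM_zero_cancel, rule Lim_null_comparison)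
    show "((\<lambda>n. 2 / real (c n)) \<longlongrightarrow> 0) sequentially"
      by (rule tendsto_divide_0[OF tendsto_const filterlim_at_top_imp_at_infinity[OF c]])
    show "\<forall>\<^sub>F n in sequentially. norm (1 / real (c n) * H (S \<inter> F n) - h) \<le> 2 / real (c n)"
      using filterlim_at_top_dense[THEN iffD1, OF c, rule_format, of 0]
    proof eventually_elim
      case (elim n)
      \<comment> \<open>\<open>elim\<close> says that \<open>c n\<close> is positive, which keeps
        the default value of division by 0 out.\<close>
      have "1 / real (c n) * H (S \<inter> F n) - h = (H (S \<inter> F n) - c n * h) / c n"
        using elim by (simp add: field_simps)
      then show ?case
        using bound[of "S \<inter> F n"] F(1)[of n] elim by (simp add: c_def divide_right_mono)
    qed
  qed
  then have "(\<lambda>n. ereal (1 / real (c n) * H (S \<inter> F n))) \<longlonglongrightarrow> ereal h" by simp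
  then have "seq_entropy act M F S \<alpha> = ereal h"
    unfolding seq_entropy_def H_def[symmetric] c_def[symmetric]
    by (intro lim_imp_Limsup) simp_all
  then show ?thesis using S \<open>infinite S\<close> by (auto simp: h_def)
qed

section \<open>Sets with totally bounded orbit\<close>

lemma finitely_labelled_reindex:
  assumes "finitely_labelled J d" "\<And>i. i \<in> I \<Longrightarrow> h i \<in> J"
  shows "finitely_labelled I (\<lambda>i j. d (h i) (h j))"
  unfolding finitely_labelled_def
proof (intro allI impI)
  fix \<epsilon> :: real assume "0 < \<epsilon>"
  obtain c :: "'a \<Rightarrow> nat" where c: "finite (c ` J)" "\<forall>i\<in>J. \<forall>j\<in>J. c i = c j \<longrightarrow> d i j \<le> \<epsilon>"
    using finitely_labelledD[OF assms(1) \<open>0 < \<epsilon>\<close>] by blast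
  show "\<exists>c :: 'b \<Rightarrow> nat. finite (c ` I) \<and> (\<forall>i\<in>I. \<forall>j\<in>I. c i = c j \<longrightarrow> d (h i) (h j) \<le> \<epsilon>)"
  proof (intro exI[of _ "\<lambda>i. c (h i)"] conjI ballI impI)
    have "(\<lambda>i. c (h i)) ` I \<subseteq> c ` J" using assms(2) by blast
    then show "finite ((\<lambda>i. c (h i)) ` I)" using c(1) by (rule finite_subset)
  qed (use c(2) assms(2) in blast)
qed

context G_MPS
begin

text \<open>For fixed \<epsilon> the number of labels is fixed, so their total cost \<open>K\<close>
  vanishes after division by the size of \<open>S \<inter> F n\<close>. What remains is the cost of
  a repeated label, which lies below \<delta> for small \<epsilon>.\<close>

lemma seq_entropy_le_0:
  assumes A: "A \<in> sets M" "A \<noteq> {}" "A \<noteq> UNIV"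
    and lab: "finitely_labelled (carrier G) (\<lambda>g h. prob (sym_diff (act g -` A) (act h -` A)))"
    and S: "S \<subseteq> carrier G" "infinite S"
    and F: "\<And>n. finite (F n)" "incseq F" "(\<Union>n. F n) = carrier G"
  shows "seq_entropy act M F S {A, UNIV - A} \<le> 0"
proof (rule ereal_le_epsilon2)
  fix \<delta> :: real assume "0 < \<delta>"
  have "((\<lambda>\<epsilon>::real. - ln (1 - \<epsilon>) - \<epsilon> * ln \<epsilon>) \<longlongrightarrow> 0) (at_right 0)" by real_asymp
  from order_tendstoD(2)[OF this \<open>0 < \<delta>\<close>]
  have "\<forall>\<^sub>F \<epsilon> in at_right 0. - ln (1 - \<epsilon>) - \<epsilon> * ln \<epsilon> < \<delta> \<and> \<epsilon> \<in> {0<..<1::real}"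
    by (intro eventually_conj eventually_at_right_real) simp_all
  then obtain \<epsilon> :: real where \<epsilon>: "- ln (1 - \<epsilon>) - \<epsilon> * ln \<epsilon> < \<delta>" "0 < \<epsilon>" "\<epsilon> < 1"
    using eventually_happens'[OF trivial_limit_at_right_real] by fastforce
  obtain c :: "'g \<Rightarrow> nat" where c: "finite (c ` carrier G)"
    "\<forall>g\<in>carrier G. \<forall>h\<in>carrier G. c g = c h \<longrightarrow> prob (sym_diff (act g -` A) (act h -` A)) \<le> \<epsilon>"
    using finitely_labelledD[OF lab \<epsilon>(2)] by blast
  define K where "K = card (c ` carrier G) * ln (2::real)"
  define N where "N n = card (S \<inter> F n)" for n
  let ?H = "\<lambda>n. partition_entropy M (join_partitions M (S \<inter> F n) (\<lambda>g. preimage_partition M (act g) {A, UNIV - A}))"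
  have N: "filterlim (\<lambda>n. real (N n)) at_top sequentially"
    unfolding N_def
    by (rule filterlim_compose[OF filterlim_real_sequentially card_Int_tendsto_infinity])
       (use S F in auto)
  have "?H n \<le> K + N n * \<delta>" for n
  proof -
    have sub: "S \<inter> F n \<subseteq> carrier G" using S by blast
    have fin: "finite (S \<inter> F n)" using F(1) by simp
    have pre: "preimage_partition M (act g) {A, UNIV - A} = {act g -` A, space M - act g -` A}" for g
      by (auto simp: preimage_partition_def space_M)
    have proper: "act g -` A \<noteq> {}" "act g -` A \<noteq> space M" if "g \<in> S \<inter> F n" for g
    proof -
      have surj: "surj (act g)" using sub that by (intro surj_act) blast
      show "act g -` A \<noteq> {}" using surj A(2) by (simp add: surj_vimage_empty)
      have "act g -` (- A) \<noteq> {}" using surj A(3) by (subst surj_vimage_empty) auto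
      then show "act g -` A \<noteq> space M" unfolding space_M by blast
    qed
    have "?H n \<le> card (c ` (S \<inter> F n)) * ln 2 + card (S \<inter> F n) * (- ln (1 - \<epsilon>) - \<epsilon> * ln \<epsilon>)"
      unfolding pre
    proof (rule entropy_join_two_cells_le[OF fin _ proper _ \<epsilon>(2,3)])
      show "act g -` A \<in> sets M" if "g \<in> S \<inter> F n" for g
        using sub that A(1) by (intro sets_vimage_act) auto
      show "prob (sym_diff (act g -` A) (act h -` A)) \<le> \<epsilon>"
        if "g \<in> S \<inter> F n" "h \<in> S \<inter> F n" "c g = c h" for g h
        using c(2) sub that by blast
    qed
    also have "\<dots> \<le> K + N n * \<delta>"
      unfolding K_def N_def
      using card_mono[OF c(1) image_mono[OF sub]] \<epsilon>(1) by (intro add_mono mult_right_mono mult_left_mono) auto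
    finally show ?thesis .
  qed
  then have le: "1 / real (N n) * ?H n \<le> K / real (N n) + \<delta>" if "0 < real (N n)" for n
    using that \<open>?H n \<le> K + N n * \<delta>\<close> by (simp add: field_simps)
  have "\<forall>\<^sub>F n in sequentially. 0 < real (N n)"
    using filterlim_at_top_dense[THEN iffD1, OF N] by blast
  then have "\<forall>\<^sub>F n in sequentially. ereal (1 / real (N n) * ?H n) \<le> ereal (K / real (N n) + \<delta>)"
    by eventually_elim (use le in simp)
  then have "limsup (\<lambda>n. ereal (1 / real (N n) * ?H n)) \<le> limsup (\<lambda>n. ereal (K / real (N n) + \<delta>))"
    by (rule Limsup_mono)
  also have "(\<lambda>n. K / real (N n) + \<delta>) \<longlonglongrightarrow> 0 + \<delta>"
    by (intro tendsto_add tendsto_const tendsto_divide_0[OF tendsto_const filterlim_at_top_imp_at_infinity[OF N]])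
  then have "(\<lambda>n. ereal (K / real (N n) + \<delta>)) \<longlonglongrightarrow> ereal \<delta>" by simp
  then have "limsup (\<lambda>n. ereal (K / real (N n) + \<delta>)) = ereal \<delta>"
    by (intro lim_imp_Limsup) simp_all
  finally show "seq_entropy act M F S {A, UNIV - A} \<le> 0 + ereal \<delta>"
    by (simp add: seq_entropy_def N_def)
qed

section \<open>Section functions of an invariant set\<close>

definition diag_invariant :: "('x \<times> 'x) set \<Rightarrow> bool" where
  "diag_invariant E \<longleftrightarrow> E \<in> sets (M \<Otimes>\<^sub>M M) \<and>
     (\<forall>g\<in>carrier G. \<forall>x y. (act g x, act g y) \<in> E \<longleftrightarrow> (x, y) \<in> E)"

text \<open>By invariance of \<open>E\<close>, pulling the section at \<open>act g x\<close> back
  under \<open>act g\<close> gives the section at x. Translating the section function is thus the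
  same as replacing \<open>B\<close> by its preimage, which places the whole orbit in the family of
  \<open>finitely_labelled_sections\<close>.\<close>

lemma section_equivariant:
  assumes E: "diag_invariant E" and B: "B \<in> sets M" and g: "g \<in> carrier G"
  shows "prob (Pair (act g x) -` E \<inter> B) = prob (Pair x -` E \<inter> act g -` B)"
proof -
  have "Pair (act g x) -` E \<inter> B \<in> sets M"
    using E B sets_section by (auto simp: diag_invariant_def)
  from prob_vimage_act[OF g this]
  have "prob (Pair (act g x) -` E \<inter> B) = prob (act g -` (Pair (act g x) -` E \<inter> B))" by simp
  also have "act g -` (Pair (act g x) -` E \<inter> B) = Pair x -` E \<inter> act g -` B"
    using E g by (auto simp: diag_invariant_def)
  finally show ?thesis .
qed

text \<open>The orbit of a section function lies in a totally bounded family, and so does the orbit of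
  almost each of its level sets.\<close>
lemma section_AE_const:
  assumes no: "\<And>A. A \<in> sets M \<Longrightarrow> 0 < prob A \<Longrightarrow> prob A < 1 \<Longrightarrow>
      \<not> finitely_labelled (carrier G) (\<lambda>g h. prob (sym_diff (act g -` A) (act h -` A)))"
    and E: "diag_invariant E" and B: "B \<in> sets M"
  shows "AE x in M. prob (Pair x -` E \<inter> B) = expectation (\<lambda>x. prob (Pair x -` E \<inter> B))"
proof (rule ccontr)
  let ?f = "\<lambda>x. prob (Pair x -` E \<inter> B)"
  assume nc: "\<not> ?thesis"
  have E': "E \<in> sets (M \<Otimes>\<^sub>M M)" using E by (simp add: diag_invariant_def)
  have int: "integrable M ?f" by (rule integrable_prob_section_Int[OF E' B])
  then have f_meas: "?f \<in> borel_measurable M" by (rule borel_measurable_integrable)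
  obtain t where t: "0 < prob {x \<in> space M. ?f x < t}" "prob {x \<in> space M. ?f x < t} < 1"
    "prob {x \<in> space M. ?f x = t} = 0"
    using nonconstant_level[OF int nc] .
  define A where "A = {x \<in> space M. ?f x < t}"
  have A: "A \<in> sets M" unfolding A_def using f_meas by measurable
  have equi: "?f (act g x) = prob (Pair x -` E \<inter> act g -` B)" if "g \<in> carrier G" for g x
    by (rule section_equivariant[OF E B that])
  have "finitely_labelled (carrier G) (\<lambda>g h. prob (sym_diff {x \<in> space M. ?f (act g x) < t} {x \<in> space M. ?f (act h x) < t}))"
  proof (rule finitely_labelled_level_sets)
    show "integrable M (\<lambda>x. ?f (act g x))" if "g \<in> carrier G" for g
      unfolding equi[OF that] by (rule integrable_prob_section_Int[OF E' sets_vimage_act[OF that B]])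
    have "finitely_labelled (carrier G) (\<lambda>g h. section_dist E (act g -` B) (act h -` B))"
      by (rule finitely_labelled_reindex[OF finitely_labelled_sections[OF E']]) (rule sets_vimage_act[OF _ B])
    then show "finitely_labelled (carrier G) (\<lambda>g h. expectation (\<lambda>x. \<bar>?f (act g x) - ?f (act h x)\<bar>))"
      by (rule finitely_labelled_mono) (simp add: equi section_dist_def)
    \<comment> \<open>The sets for different g are preimages of one set under measure-preserving
      maps, so one \<delta> serves the whole orbit.\<close>
    fix \<epsilon> :: real assume "0 < \<epsilon>"
    from level_neighbourhood_small[OF f_meas t(3) this]
    obtain \<delta> where \<delta>: "0 < \<delta>" "prob {x \<in> space M. \<bar>?f x - t\<bar> < \<delta>} \<le> \<epsilon>" by blast
    have "{x \<in> space M. \<bar>?f x - t\<bar> < \<delta>} \<in> sets M" using f_meas by measurable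
    from prob_vimage_act[OF _ this]
    have "prob {x \<in> space M. \<bar>?f (act g x) - t\<bar> < \<delta>} \<le> \<epsilon>" if "g \<in> carrier G" for g
      using \<delta>(2) that by (simp add: space_M vimage_def)
    then show "\<exists>\<delta>>0. \<forall>g\<in>carrier G. prob {x \<in> space M. \<bar>?f (act g x) - t\<bar> < \<delta>} \<le> \<epsilon>"
      using \<delta>(1) by blast
  qed
  then have "finitely_labelled (carrier G) (\<lambda>g h. prob (sym_diff (act g -` A) (act h -` A)))"
    by (simp add: A_def space_M vimage_def)
  then show False using no[OF A] t(1,2) by (simp add: A_def)
qed

text \<open>By Fubini the left side is the integral over \<open>A\<close> of the section function,
  which is almost everywhere a constant; the case of the whole space in place of \<open>A\<close>
  identifies the constant.\<close>

lemma measure_Int_rectangle: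
  assumes E: "E \<in> sets (M \<Otimes>\<^sub>M M)" and A: "A \<in> sets M" and B: "B \<in> sets M"
    and const: "AE x in M. prob (Pair x -` E \<inter> B) = expectation (\<lambda>x. prob (Pair x -` E \<inter> B))"
  shows "pair.prob (E \<inter> A \<times> B) = prob A * pair.prob (E \<inter> UNIV \<times> B)"
proof -
  have U: "UNIV \<in> sets M" using sets.top[of M] by (simp add: space_M)
  have rect: "pair.prob (E \<inter> C \<times> B) = expectation (\<lambda>x. indicator C x * prob (Pair x -` E \<inter> B))"
    if C: "C \<in> sets M" for C
  proof -
    have "E \<inter> C \<times> B \<in> sets (M \<Otimes>\<^sub>M M)" using E B C by simp
    from measure_pair_eq_section[OF this]
    have "pair.prob (E \<inter> C \<times> B) = expectation (\<lambda>x. prob (Pair x -` (E \<inter> C \<times> B)))" .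
    also have "\<dots> = expectation (\<lambda>x. indicator C x * prob (Pair x -` E \<inter> B))"
    proof (rule Bochner_Integration.integral_cong[OF refl])
      fix x
      have "Pair x -` (E \<inter> C \<times> B) = (if x \<in> C then Pair x -` E \<inter> B else {})" by auto
      then show "prob (Pair x -` (E \<inter> C \<times> B)) = indicator C x * prob (Pair x -` E \<inter> B)" by simp
    qed
    finally show ?thesis .
  qed
  let ?m = "expectation (\<lambda>x. prob (Pair x -` E \<inter> B))"
  have "pair.prob (E \<inter> A \<times> B) = expectation (\<lambda>x. indicator A x * prob (Pair x -` E \<inter> B))"
    by (rule rect[OF A])
  also have "\<dots> = expectation (\<lambda>x. indicator A x * ?m)"
  proof (rule integral_cong_AE)
    show "(\<lambda>x. indicator A x * prob (Pair x -` E \<inter> B)) \<in> borel_measurable M"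
      using A borel_measurable_integrable[OF integrable_prob_section_Int[OF E B]] by measurable
    show "(\<lambda>x. indicator A x * ?m) \<in> borel_measurable M" using A by measurable
    show "AE x in M. indicator A x * prob (Pair x -` E \<inter> B) = indicator A x * ?m"
      using const by eventually_elim simp
  qed
  also have "\<dots> = prob A * ?m" using A by (simp add: less_top[symmetric])
  also have "?m = pair.prob (E \<inter> UNIV \<times> B)" using rect[OF U] by simp
  finally show ?thesis .
qed

text \<open>Lets a factor in the second coordinate be treated as one in the first.\<close>

lemma pair_prob_swap:
  assumes "E \<in> sets (M \<Otimes>\<^sub>M M)"
  shows "prod.swap -` E \<in> sets (M \<Otimes>\<^sub>M M)" "pair.prob (prod.swap -` E) = pair.prob E"
proof -
  have swap: "(\<lambda>(x, y). (y, x)) = (prod.swap :: 'x \<times> 'x \<Rightarrow> 'x \<times> 'x)" by auto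
  have space: "space (M \<Otimes>\<^sub>M M) = UNIV" by (simp add: space_pair_measure space_M)
  have meas: "prod.swap \<in> measurable (M \<Otimes>\<^sub>M M) (M \<Otimes>\<^sub>M M)"
    using measurable_pair_swap'[of M M] unfolding swap .
  show "prod.swap -` E \<in> sets (M \<Otimes>\<^sub>M M)"
    using measurable_sets[OF meas assms] by (simp add: space)
  have "pair.prob E = measure (distr (M \<Otimes>\<^sub>M M) (M \<Otimes>\<^sub>M M) prod.swap) E"
    using pair.distr_pair_swap unfolding swap by simp
  also have "\<dots> = pair.prob (prod.swap -` E)"
    using measure_distr[OF meas assms] by (simp add: space)
  finally show "pair.prob (prod.swap -` E) = pair.prob E" by simp
qed

text \<open>If all section functions are constant, then an invariant set is independent of all
  rectangles, hence of itself.\<close>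
lemma not_weakly_mixing_imp_compact_set:
  assumes "\<not> weakly_mixing G act M"
  obtains A where "A \<in> sets M" "0 < prob A" "prob A < 1"
    "finitely_labelled (carrier G) (\<lambda>g h. prob (sym_diff (act g -` A) (act h -` A)))"
proof (rule ccontr)
  assume "\<not> thesis"
  then have no: "\<not> finitely_labelled (carrier G) (\<lambda>g h. prob (sym_diff (act g -` A) (act h -` A)))"
    if "A \<in> sets M" "0 < prob A" "prob A < 1" for A
    using that \<open>\<And>A. A \<in> sets M \<Longrightarrow> 0 < prob A \<Longrightarrow> prob A < 1 \<Longrightarrow> _ \<Longrightarrow> thesis\<close> by blast
  have space: "space (M \<Otimes>\<^sub>M M) = UNIV" by (simp add: space_pair_measure space_M)
  obtain E where E: "E \<in> sets (M \<Otimes>\<^sub>M M)" "\<And>g. g \<in> carrier G \<Longrightarrow> diag_act g -` E = E"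
    "pair.prob E \<noteq> 0" "pair.prob E \<noteq> 1"
    using assms unfolding weakly_mixing_def ergodic_action_def space by auto
  have "(act g x, act g y) \<in> E \<longleftrightarrow> (x, y) \<in> E" if "g \<in> carrier G" for g x y
    using arg_cong[OF E(2)[OF that], of "\<lambda>X. (x, y) \<in> X"] by simp
  then have inv: "diag_invariant E" "diag_invariant (prod.swap -` E)"
    using E(1) pair_prob_swap(1) by (simp_all add: diag_invariant_def)
  have U: "UNIV \<in> sets M" using sets.top[of M] by (simp add: space_M)
  let ?R = "{A \<times> B | A B. A \<in> sets M \<and> B \<in> sets M}"
  have R: "?R \<subseteq> Pow (space M \<times> space M)" by (simp add: space_M)
  have "pair.prob (E \<inter> C) = pair.prob E * pair.prob C" if C: "C \<in> sets (M \<Otimes>\<^sub>M M)" for C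
    using Int_stable_pair_measure_generator[of M M] R C[unfolded sets_pair_measure]
  proof (induction C rule: sigma_sets_induct_disjoint)
    case (basic C)
    then obtain A B where C: "C = A \<times> B" and A: "A \<in> sets M" and B: "B \<in> sets M" by blast
    have "pair.prob (E \<inter> A \<times> B) = prob A * pair.prob (E \<inter> UNIV \<times> B)"
      by (rule measure_Int_rectangle[OF E(1) A B section_AE_const[OF no inv(1) B]])
    \<comment> \<open>Constancy of the section function has split off \<open>A\<close>. After
      transposition \<open>B\<close> is the first factor and is split off in the same way, by the
      section function of the transposed set.\<close>
    also have "pair.prob (E \<inter> UNIV \<times> B) = pair.prob (prod.swap -` (E \<inter> UNIV \<times> B))"
      using E(1) U B by (intro pair_prob_swap(2)[symmetric]) simp
    also have "prod.swap -` (E \<inter> UNIV \<times> B) = prod.swap -` E \<inter> B \<times> UNIV" by auto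
    also have "pair.prob \<dots> = prob B * pair.prob (prod.swap -` E \<inter> UNIV \<times> UNIV)"
      by (rule measure_Int_rectangle[OF pair_prob_swap(1)[OF E(1)] B U section_AE_const[OF no inv(2) U]])
    also have "pair.prob (prod.swap -` E \<inter> UNIV \<times> UNIV) = pair.prob E"
      using pair_prob_swap(2)[OF E(1)] by simp
    also have "prob A * (prob B * pair.prob E) = pair.prob E * pair.prob (A \<times> B)"
      using A B by (simp add: measure_def emeasure_pair_measure_Times enn2real_mult)
    finally show ?case by (simp add: C)
  next
    case empty
    show ?case by simp
  next
    case (compl C)
    have C: "C \<in> sets (M \<Otimes>\<^sub>M M)" using compl.hyps by (simp add: sets_pair_measure)
    have "pair.prob (E \<inter> (space M \<times> space M - C)) = pair.prob (E - E \<inter> C)"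
      by (rule arg_cong[where f = pair.prob]) (auto simp: space_M)
    also have "\<dots> = pair.prob E - pair.prob (E \<inter> C)"
      using E(1) C by (intro pair.finite_measure_Diff) auto
    also have "\<dots> = pair.prob E * (1 - pair.prob C)" by (simp add: compl.IH right_diff_distrib)
    also have "1 - pair.prob C = pair.prob (space M \<times> space M - C)"
      using pair.prob_compl[OF C] by (simp add: space_pair_measure)
    finally show ?case .
  next
    case (union D)
    have D: "range D \<subseteq> sets (M \<Otimes>\<^sub>M M)" using union.hyps(2) by (simp add: sets_pair_measure)
    have "(\<lambda>n. pair.prob (E \<inter> D n)) sums pair.prob (\<Union>n. E \<inter> D n)"
      using D E(1) union.hyps(1)
      by (intro pair.finite_measure_UNION) (auto simp: disjoint_family_on_def)
    moreover have "(\<lambda>n. pair.prob E * pair.prob (D n)) sums (pair.prob E * pair.prob (\<Union>n. D n))"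
      using D union.hyps(1) by (intro sums_mult pair.finite_measure_UNION)
    ultimately have "pair.prob (\<Union>n. E \<inter> D n) = pair.prob E * pair.prob (\<Union>n. D n)"
      using union.IH by (simp add: sums_iff)
    then show ?case by simp
  qed
  \<comment> \<open>Independence of \<open>E\<close> from itself equates its measure with the square
    of its measure.\<close>
  from this[OF E(1)] have "pair.prob E * pair.prob E = pair.prob E * 1" by simp
  then show False using E(3,4) by simp
qed

lemma not_weakly_mixing_imp_zero_entropy:
  assumes "\<not> weakly_mixing G act M"
    and F: "\<And>n. finite (F n)" "incseq F" "(\<Union>n. F n) = carrier G"
  shows "\<exists>\<alpha>. finite_measurable_partition M \<alpha> \<and> nontrivial_partition M \<alpha> \<and>
    (\<forall>S\<subseteq>carrier G. infinite S \<longrightarrow> seq_entropy act M F S \<alpha> \<le> 0)"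
proof -
  obtain A where A: "A \<in> sets M" "0 < prob A" "prob A < 1"
    "finitely_labelled (carrier G) (\<lambda>g h. prob (sym_diff (act g -` A) (act h -` A)))"
    using not_weakly_mixing_imp_compact_set[OF assms(1)] .
  have ne: "A \<noteq> {}" "A \<noteq> UNIV" using A(2,3) prob_space by (auto simp: space_M)
  have "UNIV - A \<in> sets M" using sets.compl_sets[OF A(1)] by (simp add: space_M)
  then have "finite_measurable_partition M {A, UNIV - A}"
    using A(1) ne by (intro finite_partitionI) (auto simp: space_M)
  moreover have "nontrivial_partition M {A, UNIV - A}"
    using A(2,3) by (simp add: nontrivial_partition_def)
  ultimately show ?thesis
    using seq_entropy_le_0[OF A(1) ne A(4) _ _ F] by blast
qed

end

section \<open>Positivity of entropy and the cycle of implications\<close>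

lemma (in prob_space) partition_entropy_pos:
  assumes \<alpha>: "finite_measurable_partition M \<alpha>" and "nontrivial_partition M \<alpha>"
  shows "0 < partition_entropy M \<alpha>"
proof -
  obtain A where A: "A \<in> \<alpha>" "0 < prob A" "prob A < 1"
    using assms(2) by (auto simp: nontrivial_partition_def)
  have "0 < eta (prob A)" using A by (simp add: eta_def mult_pos_neg)
  also have "eta (prob A) \<le> partition_entropy M \<alpha>"
    unfolding partition_entropy_eta using finite_partitionD(1)[OF \<alpha>] A(1)
    by (intro member_le_sum) (auto intro: eta_nonneg)
  finally show ?thesis .
qed

theorem theorem3p7:
  fixes G :: "('g, 'b) monoid_scheme"
    and F :: "nat \<Rightarrow> 'g set"
    and act :: "'g \<Rightarrow> 'x::metric_space \<Rightarrow> 'x"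
    and M :: "'x measure"
  assumes "countable_amenable_group G"
    and "infinite (carrier G)"
    and "folner_sequence G F"
    and "G_MPS G act M"
  shows
    "(weakly_mixing G act M
        \<longleftrightarrow> (\<forall>\<alpha>. finite_measurable_partition M \<alpha> \<longrightarrow>
              (\<exists>S\<subseteq>carrier G. infinite S \<and>
                 seq_entropy act M F S \<alpha> = ereal (partition_entropy M \<alpha>))))
     \<and> (weakly_mixing G act M
        \<longleftrightarrow> (\<forall>\<alpha>. finite_measurable_partition M \<alpha> \<and> nontrivial_partition M \<alpha> \<longrightarrow>
              (\<exists>S\<subseteq>carrier G. infinite S \<and> seq_entropy act M F S \<alpha> > 0)))"
    (is "(?wm \<longleftrightarrow> ?full) \<and> (?wm \<longleftrightarrow> ?pos)")
proof -
  interpret A: countable_amenable_group G by fact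
  interpret F: folner_sequence G F by fact
  interpret G_MPS G act M by fact
  \<comment> \<open>Both equivalences follow from the cycle \<open>?wm\<close>,
    \<open>?full\<close>, \<open>?pos\<close>, \<open>?wm\<close>. Its middle link holds because a
    nontrivial partition has positive entropy.\<close>
  have "?full" if "?wm"
    using weakly_mixing_imp_full_entropy[OF A.countable_carrier assms(2) that F.finite_F F.incseq_F F.Union_F]
    by blast
  moreover have "?pos" if "?full"
    using that partition_entropy_pos by (metis ereal_less(2))
  moreover have "?wm" if "?pos"
  proof (rule ccontr)
    assume "\<not> ?wm"
    from not_weakly_mixing_imp_zero_entropy[OF this F.finite_F F.incseq_F F.Union_F] that
    show False by (meson leD)
  qed
  ultimately show ?thesis by blast
qed

end
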